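(* Let $\beta>1/2$, and let $\{X_i\}_{i=1}^n$ be i.i.d. random variables with distribution $P_{f_\varepsilon}=(1-\varepsilon)P_f+\varepsilon G$, where $P_f$ is the distribution with density $f\in\mathcal{F}_\beta$ (the Sobolev class defined in the context via a wavelet basis) and $G$ is an arbitrary distribution on $[0,1]$. For $\alpha\in(0,1)$ and $\varepsilon\in[0,1]$, the private wavelet estimator $\hat f_{\mathrm{Lap}}$ defined in the context, with privacy mechanism $Q$, satisfies $$\mathbb{E}_{P_{f_\varepsilon},Q}(\|\hat f_{\mathrm{Lap}}-f\|_\infty)\ \lesssim\ \Big\{\frac{\log(n\alpha^2)}{n\alpha^2}\Big\}^{\frac{2\beta-1}{4\beta+2}}\ \vee\ \varepsilon^{\frac{2\beta-1}{2\beta+1}},$$ with the tuning parameter $J$ satisfying $$2^J\asymp\Big\{\frac{\log(n\alpha^2)}{n\alpha^2}\Big\}^{-\frac{1}{2\beta+1}}\wedge\varepsilon^{-\frac{2}{2\beta+1}}.$$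
   Context: Wavelet basis: $\phi,\psi:[-A,A]\to\mathbb{R}$ are a father and mother wavelet, $A>0$ an absolute constant, with $\int\psi=0$, $\|\psi\|_\infty<\infty$, $\|\phi\|_\infty<\infty$; $\psi_{-1k}=\phi(\cdot-k)$ and $\psi_{jk}=2^{j/2}\psi(2^j(\cdot)-k)$ for $j\ge0$, $k\in\mathbb{Z}$, form an orthonormal basis of $L^2(\mathbb{R})$ (it may be periodised or boundary-corrected to a basis of $L^2[0,1]$ with the same properties). For $f$ supported on $[0,1]$ write $\beta_{jk}=\int f\psi_{jk}$, and let $\mathcal{N}_j$ be the finite set of $k$ for which $\beta_{jk}$ can be non-zero for functions supported on $[0,1]$. The Sobolev class is $$\mathcal{F}_\beta=\Big\{f:[0,1]\to\mathbb{R}_+:\ \int_0^1f=1,\ \sum_{j\ge-1}2^{2j\beta}\sum_{k\in\mathcal{N}_j}\beta_{jk}^2<\infty\Big\}.$$ Privacy mechanism $Q$ and estimator: for a tuning parameter $J\in\mathbb{N}_+$, $i\in\{1,\dots,n\}$, $j\in\{-1,0,\dots,J\}$, $k\in\mathcal{N}_j$, let $W_{ijk}$ be independent standard Laplace variables (density $\frac12e^{-|w|}$), independent of the data, and $$\sigma_J=C2^{J/2}/\alpha,\quad C=(8\lceil A\rceil+4)\|\psi\|_\infty\sqrt2(\sqrt2-1)^{-1},\qquad Z_{ijk}=\psi_{jk}(X_i)+\sigma_JW_{ijk},$$ $$\hat\beta_{jk}=\frac1n\sum_{i=1}^nZ_{ijk},\qquad\hat f_{\mathrm{Lap}}=\sum_{j=-1}^J\sum_{k\in\mathcal{N}_j}\hat\beta_{jk}\psi_{jk}.$$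 $\|g\|_\infty=\sup_{x\in[0,1]}|g(x)|$; $a\wedge b=\min(a,b)$, $a\vee b=\max(a,b)$; $\varepsilon^{-2/(2\beta+1)}=+\infty$ if $\varepsilon=0$. The quantities $\alpha,\varepsilon$ may depend on $n$, with $n\alpha^2\to\infty$. $a_n\lesssim b_n$ means there is a constant $C'>0$ with $\limsup_na_n/b_n\le C'$, where $C'$ does not depend on $n,\alpha,\varepsilon,G$ but may depend on $\beta$, the wavelets and an upper bound on the Sobolev sum of $f$; $a_n\asymp b_n$ means $a_n\lesssim b_n\lesssim a_n$.
   Formalization: Since the class is unchanged when f is altered on a null set, the bound with a literal supremum fails for some versions of f; it is proved with the essential supremum for every f, and with the literal supremum when f equals its wavelet series at each point of [0,1]. *)

theory Defs
  imports "HOL-Probability.Probability"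
begin

definition square_integrable :: "(real \<Rightarrow> real) \<Rightarrow> bool" where
  "square_integrable g \<longleftrightarrow> g \<in> borel_measurable borel \<and> integrable lborel (\<lambda>x. (g x)\<^sup>2)"

definition orthonormal_basis_L2 :: "'i set \<Rightarrow> ('i \<Rightarrow> real \<Rightarrow> real) \<Rightarrow> bool" where
  "orthonormal_basis_L2 I e \<longleftrightarrow>
     (\<forall>i\<in>I. square_integrable (e i)) \<and>
     (\<forall>i\<in>I. \<forall>i'\<in>I. (LBINT x. e i x * e i' x) = (if i = i' then 1 else 0)) \<and>
     (\<forall>g. square_integrable g \<longrightarrow> (\<forall>\<delta>>0. \<exists>S c. finite S \<and> S \<subseteq> I \<and>
        (LBINT x. (g x - (\<Sum>i\<in>S. c i * e i x))\<^sup>2) < \<delta>))"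

text \<open>Level \<open>j = -1\<close> consists of the translates of the father wavelet; the function is only
  meaningful for \<open>j \<ge> -1\<close>.\<close>

definition wav :: "(real \<Rightarrow> real) \<Rightarrow> (real \<Rightarrow> real) \<Rightarrow> int \<Rightarrow> int \<Rightarrow> real \<Rightarrow> real" where
  "wav \<phi> \<psi> j k x =
     (if j = -1 then \<phi> (x - of_int k)
      else 2 powr (of_int j / 2) * \<psi> (2 powr of_int j * x - of_int k))"

text \<open>Functions on \<open>[-A, A]\<close> are extended by zero to the real line.\<close>

definition wavelet_pair :: "real \<Rightarrow> (real \<Rightarrow> real) \<Rightarrow> (real \<Rightarrow> real) \<Rightarrow> bool" where
  "wavelet_pair A \<phi> \<psi> \<longleftrightarrow>
     0 < A \<and>
     \<phi> \<in> borel_measurable borel \<and> \<psi> \<in> borel_measurable borel \<and>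
     (\<forall>x. x \<notin> {-A..A} \<longrightarrow> \<phi> x = 0 \<and> \<psi> x = 0) \<and>
     bounded (range \<phi>) \<and> bounded (range \<psi>) \<and>
     (LBINT x. \<psi> x) = 0 \<and>
     orthonormal_basis_L2 ({-1..} \<times> UNIV) (\<lambda>(j, k). wav \<phi> \<psi> j k)"

definition wav_coeff ::
    "(real \<Rightarrow> real) \<Rightarrow> (real \<Rightarrow> real) \<Rightarrow> (real \<Rightarrow> real) \<Rightarrow> int \<Rightarrow> int \<Rightarrow> real" where
  "wav_coeff \<phi> \<psi> f j k = (LBINT x. f x * wav \<phi> \<psi> j k x)"

definition active :: "(real \<Rightarrow> real) \<Rightarrow> (real \<Rightarrow> real) \<Rightarrow> int \<Rightarrow> int set" where
  "active \<phi> \<psi> j =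
     {k. \<exists>f. square_integrable f \<and> (\<forall>x. x \<notin> {0..1} \<longrightarrow> f x = 0) \<and> wav_coeff \<phi> \<psi> f j k \<noteq> 0}"

lemma finite_active:
  assumes "wavelet_pair A \<phi> \<psi>"
  shows "finite (active \<phi> \<psi> j)"
proof -
  define s :: real where "s = (if j = -1 then 1 else 2 powr of_int j)"
  have "s > 0" by (simp add: s_def)
  have zero: "\<phi> y = 0" "\<psi> y = 0" if "y \<notin> {-A..A}" for y
    using assms that unfolding wavelet_pair_def by blast+
  have "k \<in> {-\<lceil>A\<rceil>..\<lceil>s + A\<rceil>}" if "k \<in> active \<phi> \<psi> j" for k
  proof (rule ccontr)
    assume "k \<notin> {-\<lceil>A\<rceil>..\<lceil>s + A\<rceil>}"
    then have k: "of_int k < -A \<or> of_int k > s + A" by (auto; linarith)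
    from that obtain f where f: "\<And>x. x \<notin> {0..1} \<Longrightarrow> f x = 0" "wav_coeff \<phi> \<psi> f j k \<noteq> 0"
      unfolding active_def by blast
    have "f x * wav \<phi> \<psi> j k x = 0" for x
    proof (cases "x \<in> {0..1}")
      case True
      then have "0 \<le> s * x" "s * x \<le> s" using \<open>s > 0\<close> by (auto simp: mult_left_le)
      then have "s * x - of_int k \<notin> {-A..A}" using k by auto
      then show ?thesis using zero by (auto simp: wav_def s_def split: if_splits)
    qed (simp add: f)
    then have "(\<lambda>x. f x * wav \<phi> \<psi> j k x) = (\<lambda>_. 0)" by blast
    then have "wav_coeff \<phi> \<psi> f j k = 0" by (simp add: wav_coeff_def del: mult_eq_0_iff)
    then show False using f by blast
  qed
  then show ?thesis by (meson finite_atLeastAtMost_int finite_subset subsetI)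
qed

definition sobolev_sum ::
    "(real \<Rightarrow> real) \<Rightarrow> (real \<Rightarrow> real) \<Rightarrow> real \<Rightarrow> (real \<Rightarrow> real) \<Rightarrow> ennreal" where
  "sobolev_sum \<phi> \<psi> \<beta> f =
     (\<Sum>\<^sub>\<infinity>j\<in>{-1..}. ennreal (2 powr (2 * of_int j * \<beta>) *
        (\<Sum>k\<in>active \<phi> \<psi> j. (wav_coeff \<phi> \<psi> f j k)\<^sup>2)))"

definition sobolev_class ::
    "(real \<Rightarrow> real) \<Rightarrow> (real \<Rightarrow> real) \<Rightarrow> real \<Rightarrow> (real \<Rightarrow> real) set" where
  "sobolev_class \<phi> \<psi> \<beta> =
     {f. f \<in> borel_measurable borel \<and> (\<forall>x. 0 \<le> f x) \<and> (\<forall>x. x \<notin> {0..1} \<longrightarrow> f x = 0) \<and>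
         (\<integral>\<^sup>+x. ennreal (f x) \<partial>lborel) = 1 \<and> sobolev_sum \<phi> \<psi> \<beta> f < \<infinity>}"

text \<open>Membership in the Sobolev class does not change when \<open>f\<close> is modified on a null set, so it
  does not control \<open>f\<close> pointwise. The predicate below singles out the version of \<open>f\<close> that is
  given at every point of \<open>[0,1]\<close> by its wavelet series; for \<open>\<beta> > 1/2\<close> that series converges
  uniformly.\<close>

definition is_wavelet_series ::
    "(real \<Rightarrow> real) \<Rightarrow> (real \<Rightarrow> real) \<Rightarrow> (real \<Rightarrow> real) \<Rightarrow> bool" where
  "is_wavelet_series \<phi> \<psi> f \<longleftrightarrow>
     (\<forall>x\<in>{0..1}. ((\<lambda>j. \<Sum>k\<in>active \<phi> \<psi> j. wav_coeff \<phi> \<psi> f j k * wav \<phi> \<psi> j k x) has_sum f x) {-1..})"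

definition contaminated :: "real \<Rightarrow> real measure \<Rightarrow> real measure \<Rightarrow> real measure" where
  "contaminated \<epsilon> P G = measure_of UNIV (sets borel)
     (\<lambda>B. ennreal (1 - \<epsilon>) * emeasure P B + ennreal \<epsilon> * emeasure G B)"

lemma sets_contaminated [simp]: "sets (contaminated \<epsilon> P G) = sets borel"
  by (simp add: contaminated_def sets.sigma_sets_eq flip: space_borel)

lemma emeasure_contaminated:
  assumes "sets P = sets borel" "sets G = sets borel" "B \<in> sets borel"
  shows "emeasure (contaminated \<epsilon> P G) B = ennreal (1 - \<epsilon>) * emeasure P B + ennreal \<epsilon> * emeasure G B"
proof (rule emeasure_measure_of[OF contaminated_def])
  show "B \<in> sets (contaminated \<epsilon> P G)" using assms by simp
  show "positive (sets (contaminated \<epsilon> P G))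
      (\<lambda>B. ennreal (1 - \<epsilon>) * emeasure P B + ennreal \<epsilon> * emeasure G B)"
    by (simp add: positive_def)
  show "countably_additive (sets (contaminated \<epsilon> P G))
      (\<lambda>B. ennreal (1 - \<epsilon>) * emeasure P B + ennreal \<epsilon> * emeasure G B)"
    unfolding countably_additive_def
  proof (intro allI impI)
    fix F :: "nat \<Rightarrow> real set"
    assume F: "range F \<subseteq> sets (contaminated \<epsilon> P G)" "disjoint_family F"
    then show "(\<Sum>i. ennreal (1 - \<epsilon>) * emeasure P (F i) + ennreal \<epsilon> * emeasure G (F i)) =
        ennreal (1 - \<epsilon>) * emeasure P (\<Union>i. F i) + ennreal \<epsilon> * emeasure G (\<Union>i. F i)"
      using assms by (simp add: suminf_add[symmetric] suminf_emeasure)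
  qed
qed simp

definition std_laplace :: "real measure" where
  "std_laplace = density lborel (\<lambda>w. ennreal (exp (- \<bar>w\<bar>) / 2))"

definition noise_scale :: "real \<Rightarrow> (real \<Rightarrow> real) \<Rightarrow> real \<Rightarrow> nat \<Rightarrow> real" where
  "noise_scale A \<psi> \<alpha> J =
     ((8 * of_int \<lceil>A\<rceil> + 4) * (SUP x. \<bar>\<psi> x\<bar>) * sqrt 2 * inverse (sqrt 2 - 1)) * 2 powr (real J / 2) / \<alpha>"

definition noise_index ::
    "(real \<Rightarrow> real) \<Rightarrow> (real \<Rightarrow> real) \<Rightarrow> nat \<Rightarrow> nat \<Rightarrow> (nat \<times> int \<times> int) set" where
  "noise_index \<phi> \<psi> n J = {1..n} \<times> (SIGMA j:{-1..int J}. active \<phi> \<psi> j)"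

text \<open>The whole family of data and noise variables is mutually independent, i.e. the data are
  independent, the noise variables are independent, and both groups are independent of each
  other.\<close>

definition private_sample ::
    "(real \<Rightarrow> real) \<Rightarrow> (real \<Rightarrow> real) \<Rightarrow> nat \<Rightarrow> nat \<Rightarrow> real measure \<Rightarrow>
     'a measure \<Rightarrow> (nat \<Rightarrow> 'a \<Rightarrow> real) \<Rightarrow> (nat \<times> int \<times> int \<Rightarrow> 'a \<Rightarrow> real) \<Rightarrow> bool" where
  "private_sample \<phi> \<psi> n J P M X W \<longleftrightarrow>
     prob_space M \<and>
     prob_space.indep_vars M (\<lambda>_. borel) (case_sum X W) ({1..n} <+> noise_index \<phi> \<psi> n J) \<and>
     (\<forall>i\<in>{1..n}. distr M borel (X i) = P) \<and>
     (\<forall>t\<in>noise_index \<phi> \<psi> n J. distr M borel (W t) = std_laplace)"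

definition privatised ::
    "real \<Rightarrow> (real \<Rightarrow> real) \<Rightarrow> (real \<Rightarrow> real) \<Rightarrow> real \<Rightarrow> nat \<Rightarrow>
     (nat \<Rightarrow> 'a \<Rightarrow> real) \<Rightarrow> (nat \<times> int \<times> int \<Rightarrow> 'a \<Rightarrow> real) \<Rightarrow> nat \<Rightarrow> int \<Rightarrow> int \<Rightarrow> 'a \<Rightarrow> real" where
  "privatised A \<phi> \<psi> \<alpha> J X W i j k \<omega> = wav \<phi> \<psi> j k (X i \<omega>) + noise_scale A \<psi> \<alpha> J * W (i, j, k) \<omega>"

definition coeff_estimate ::
    "real \<Rightarrow> (real \<Rightarrow> real) \<Rightarrow> (real \<Rightarrow> real) \<Rightarrow> real \<Rightarrow> nat \<Rightarrow> nat \<Rightarrow>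
     (nat \<Rightarrow> 'a \<Rightarrow> real) \<Rightarrow> (nat \<times> int \<times> int \<Rightarrow> 'a \<Rightarrow> real) \<Rightarrow> int \<Rightarrow> int \<Rightarrow> 'a \<Rightarrow> real" where
  "coeff_estimate A \<phi> \<psi> \<alpha> J n X W j k \<omega> =
     (1 / real n) * (\<Sum>i=1..n. privatised A \<phi> \<psi> \<alpha> J X W i j k \<omega>)"

definition f_Lap ::
    "real \<Rightarrow> (real \<Rightarrow> real) \<Rightarrow> (real \<Rightarrow> real) \<Rightarrow> real \<Rightarrow> nat \<Rightarrow> nat \<Rightarrow>
     (nat \<Rightarrow> 'a \<Rightarrow> real) \<Rightarrow> (nat \<times> int \<times> int \<Rightarrow> 'a \<Rightarrow> real) \<Rightarrow> 'a \<Rightarrow> real \<Rightarrow> real" where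
  "f_Lap A \<phi> \<psi> \<alpha> J n X W \<omega> x =
     (\<Sum>j\<in>{-1..int J}. \<Sum>k\<in>active \<phi> \<psi> j. coeff_estimate A \<phi> \<psi> \<alpha> J n X W j k \<omega> * wav \<phi> \<psi> j k x)"

definition sup_norm :: "(real \<Rightarrow> real) \<Rightarrow> ennreal" where
  "sup_norm g = (SUP x\<in>{0..1}. ennreal \<bar>g x\<bar>)"

definition ess_sup_norm :: "(real \<Rightarrow> real) \<Rightarrow> ennreal" where
  "ess_sup_norm g = esssup (restrict_space lborel {0..1}) (\<lambda>x. ennreal \<bar>g x\<bar>)"

text \<open>Expected loss as a Lebesgue integral in \<open>[0, \<infinity>]\<close>, so that finiteness is part of any bound.\<close>

definition risk ::
    "((real \<Rightarrow> real) \<Rightarrow> ennreal) \<Rightarrow> 'a measure \<Rightarrow> ('a \<Rightarrow> real \<Rightarrow> real) \<Rightarrow> (real \<Rightarrow> real) \<Rightarrow> ennreal" where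
  "risk N M fhat f = (\<integral>\<^sup>+\<omega>. N (\<lambda>x. fhat \<omega> x - f x) \<partial>M)"

definition lesssim_const :: "real \<Rightarrow> (nat \<Rightarrow> ennreal) \<Rightarrow> (nat \<Rightarrow> ennreal) \<Rightarrow> bool" where
  "lesssim_const c a b \<longleftrightarrow> limsup (\<lambda>n. a n / b n) \<le> ennreal c"

definition asymp_const :: "real \<Rightarrow> (nat \<Rightarrow> ennreal) \<Rightarrow> (nat \<Rightarrow> ennreal) \<Rightarrow> bool" where
  "asymp_const c a b \<longleftrightarrow> lesssim_const c a b \<and> lesssim_const c b a"

definition log_ratio :: "nat \<Rightarrow> real \<Rightarrow> real" where
  "log_ratio n \<alpha> = ln (real n * \<alpha>\<^sup>2) / (real n * \<alpha>\<^sup>2)"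

definition error_rate :: "real \<Rightarrow> nat \<Rightarrow> real \<Rightarrow> real \<Rightarrow> real" where
  "error_rate \<beta> n \<alpha> \<epsilon> =
     max (log_ratio n \<alpha> powr ((2 * \<beta> - 1) / (4 * \<beta> + 2))) (\<epsilon> powr ((2 * \<beta> - 1) / (2 * \<beta> + 1)))"

text \<open>The case distinction is needed since \<open>0 powr a = 0\<close> also for negative \<open>a\<close>.\<close>

definition tuning_rate :: "real \<Rightarrow> nat \<Rightarrow> real \<Rightarrow> real \<Rightarrow> ennreal" where
  "tuning_rate \<beta> n \<alpha> \<epsilon> =
     min (ennreal (log_ratio n \<alpha> powr (- 1 / (2 * \<beta> + 1))))
         (if \<epsilon> = 0 then \<infinity> else ennreal (\<epsilon> powr (- 2 / (2 * \<beta> + 1))))"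

end

theory Submission
  imports Defs
begin

text \<open>The error \<open>f_Lap - f\<close> splits into a stochastic part, the bias caused by contamination, and
  the truncated levels \<open>j > J\<close>. At every point only boundedly many wavelets of each level are
  non-zero, so a bound \<open>E\<close> on all coefficient errors costs a factor of order \<open>2 powr (J / 2)\<close> in
  the sup norm.

  The coefficient bias is at most \<open>2 * \<epsilon> * \<parallel>wav j k\<parallel>\<close>, which contributes \<open>\<epsilon> * 2 ^ J\<close>. The centred
  coefficient estimates have sub-exponential moment generating functions (Hoeffding's lemma for the
  data, an explicit integral for the Laplace noise); a union bound over the \<open>O(2 ^ J)\<close> coefficients
  contributes \<open>2 ^ J * sqrt (log_ratio n \<alpha>)\<close>. The Sobolev bound makes the truncated levels decay
  geometrically and contribute \<open>2 powr (- (\<beta> - 1 / 2) * J)\<close>. The choice of \<open>J\<close> balances the three.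

  For the essential supremum the density must agree almost everywhere with its wavelet series, although
  it is only known to be in \<open>L\<^sup>1\<close>. An \<open>L\<^sup>1\<close> function with vanishing wavelet coefficients is
  orthogonal to every compactly supported Lipschitz function, because the wavelet series of such a
  function converges uniformly; hence it vanishes.\<close>

section \<open>Bounded functions and integrability\<close>

lemma abs_le_SUP:
  fixes g :: "real \<Rightarrow> real"
  assumes "bounded (range g)"
  shows "\<bar>g x\<bar> \<le> (SUP x. \<bar>g x\<bar>)"
proof (rule cSUP_upper)
  obtain B where "\<And>x. \<bar>g x\<bar> \<le> B" using assms by (auto simp: bounded_iff)
  then show "bdd_above (range (\<lambda>x. \<bar>g x\<bar>))" by (auto intro!: bdd_aboveI)
qed simp

lemma SUP_abs_nonneg:
  fixes g :: "real \<Rightarrow> real"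
  assumes "bounded (range g)"
  shows "0 \<le> (SUP x. \<bar>g x\<bar>)"
  using abs_le_SUP[OF assms, of 0] by linarith

text \<open>\<open>a \<le> b + 1\<close> makes the bound non-negative, which settles the case where
  the interval contains no integer.\<close>

lemma card_int_interval_le:
  fixes a b :: real
  assumes "a \<le> b + 1"
  shows "finite {k::int. a \<le> of_int k \<and> of_int k \<le> b}"
    and "card {k::int. a \<le> of_int k \<and> of_int k \<le> b} \<le> b - a + 1"
proof -
  have *: "{k::int. a \<le> of_int k \<and> of_int k \<le> b} = {\<lceil>a\<rceil>..\<lfloor>b\<rfloor>}"
    by (auto simp: le_floor_iff ceiling_le_iff)
  then show "finite {k::int. a \<le> of_int k \<and> of_int k \<le> b}" by simp
  have "real (card {\<lceil>a\<rceil>..\<lfloor>b\<rfloor>}) = max 0 (of_int (\<lfloor>b\<rfloor> - \<lceil>a\<rceil> + 1))"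
    by (auto simp: max_def)
  also have "\<dots> \<le> b - a + 1"
    using assms by (auto simp: max_def) linarith
  finally show "card {k::int. a \<le> of_int k \<and> of_int k \<le> b} \<le> b - a + 1" by (simp add: *)
qed

lemma integrable_bounded_support:
  fixes g :: "real \<Rightarrow> real"
  assumes "g \<in> borel_measurable borel" "\<And>x. \<bar>g x\<bar> \<le> b" "\<And>x. g x \<noteq> 0 \<Longrightarrow> \<bar>x\<bar> \<le> B"
  shows "integrable lborel g"
proof (rule Bochner_Integration.integrable_bound)
  show "integrable lborel (\<lambda>x. b * indicator {-B..B} x :: real)"
    by (intro integrable_mult_right integrable_real_indicator) (auto simp: emeasure_lborel_Icc_eq)
  show "AE x in lborel. norm (g x) \<le> norm (b * indicator {-B..B} x)"
  proof (rule AE_I2)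
    fix x
    show "norm (g x) \<le> norm (b * indicator {-B..B} x)"
      using assms(2,3)[of x] by (cases "g x = 0") (auto simp: indicator_def)
  qed
qed (use assms in simp)

lemma square_integrable_bounded_support:
  fixes g :: "real \<Rightarrow> real"
  assumes "g \<in> borel_measurable borel" "\<And>x. \<bar>g x\<bar> \<le> b" "\<And>x. g x \<noteq> 0 \<Longrightarrow> \<bar>x\<bar> \<le> B"
  shows "square_integrable g"
  unfolding square_integrable_def
proof (intro conjI assms(1), rule integrable_bounded_support)
  show "(\<lambda>x. (g x)\<^sup>2) \<in> borel_measurable borel" using assms(1) by measurable
  show "\<bar>(g x)\<^sup>2\<bar> \<le> b\<^sup>2" for x using power_mono[OF assms(2)[of x], of 2] by simp
qed (use assms in auto)

lemma integrable_mult_bounded: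
  fixes h g :: "real \<Rightarrow> real"
  assumes "integrable lborel h" "g \<in> borel_measurable borel" "\<And>x. \<bar>g x\<bar> \<le> b"
  shows "integrable lborel (\<lambda>x. h x * g x)"
proof (rule Bochner_Integration.integrable_bound)
  show "integrable lborel (\<lambda>x. b * h x)" using assms by simp
  show "AE x in lborel. norm (h x * g x) \<le> norm (b * h x)"
  proof (rule AE_I2)
    fix x
    have "\<bar>g x\<bar> \<le> \<bar>b\<bar>" using assms(3)[of x] by simp
    then show "norm (h x * g x) \<le> norm (b * h x)"
      by (simp add: abs_mult mult.commute mult_right_mono)
  qed
qed (use assms in simp)

lemma square_integrable_mult:
  assumes "square_integrable g" "square_integrable h"
  shows "integrable lborel (\<lambda>x. g x * h x)"
proof (rule Bochner_Integration.integrable_bound)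
  show "integrable lborel (\<lambda>x. (g x)\<^sup>2 + (h x)\<^sup>2)"
    using assms by (simp add: square_integrable_def)
  show "(\<lambda>x. g x * h x) \<in> borel_measurable lborel"
    using assms unfolding square_integrable_def by (auto intro: borel_measurable_times)
  show "AE x in lborel. norm (g x * h x) \<le> norm ((g x)\<^sup>2 + (h x)\<^sup>2)"
  proof (rule AE_I2)
    fix x
    have "2 * \<bar>g x * h x\<bar> \<le> (g x)\<^sup>2 + (h x)\<^sup>2"
      using sum_squares_bound[of "\<bar>g x\<bar>" "\<bar>h x\<bar>"] by (simp add: abs_mult)
    then show "norm (g x * h x) \<le> norm ((g x)\<^sup>2 + (h x)\<^sup>2)"
      using abs_ge_zero[of "g x * h x"] by (simp del: abs_ge_zero)
  qed
qed

section \<open>Compactly supported wavelets\<close>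

locale compact_wavelet =
  fixes A :: real and \<phi> \<psi> :: "real \<Rightarrow> real"
  assumes wavelet_pair: "wavelet_pair A \<phi> \<psi>"
begin

abbreviation w :: "int \<Rightarrow> int \<Rightarrow> real \<Rightarrow> real" where "w \<equiv> wav \<phi> \<psi>"

text \<open>Father wavelets are translated but not dilated, hence the value 1 at level
  \<open>-1\<close>. With it both branches of \<open>wav\<close> depend on \<open>x\<close> only
  through \<open>scale j * x - of_int k\<close>.\<close>

definition scale :: "int \<Rightarrow> real" where
  "scale j = (if j = -1 then 1 else 2 powr of_int j)"

text \<open>The factor \<open>sqrt 2\<close> lets the bound \<open>wav_le\<close> cover the level \<open>j = -1\<close>, which carries
  no factor \<open>2 powr (j / 2)\<close>.\<close>

definition wbound :: real where
  "wbound = sqrt 2 * ((SUP x. \<bar>\<phi> x\<bar>) + (SUP x. \<bar>\<psi> x\<bar>))"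

lemma A_pos: "0 < A"
  and phi_measurable [measurable]: "\<phi> \<in> borel_measurable borel"
  and psi_measurable [measurable]: "\<psi> \<in> borel_measurable borel"
  and phi_eq_0: "x \<notin> {-A..A} \<Longrightarrow> \<phi> x = 0"
  and psi_eq_0: "x \<notin> {-A..A} \<Longrightarrow> \<psi> x = 0"
  and bounded_phi: "bounded (range \<phi>)"
  and bounded_psi: "bounded (range \<psi>)"
  and integral_psi: "(LBINT x. \<psi> x) = 0"
  and orthonormal_basis: "orthonormal_basis_L2 ({-1..} \<times> UNIV) (\<lambda>(j, k). w j k)"
  using wavelet_pair unfolding wavelet_pair_def by auto

lemma wbound_nonneg: "0 \<le> wbound"
  by (simp add: wbound_def SUP_abs_nonneg bounded_phi bounded_psi)

lemma wav_measurable [measurable]: "w j k \<in> borel_measurable borel"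
  unfolding wav_def by (cases "j = -1") simp_all

lemma scale_ge_1: "j \<ge> -1 \<Longrightarrow> 1 \<le> scale j"
  by (simp add: scale_def ge_one_powr_ge_zero)

lemma wav_le:
  assumes "j \<ge> -1"
  shows "\<bar>w j k x\<bar> \<le> wbound * 2 powr (j / 2)"
proof (cases "j = -1")
  case True
  have e: "wbound * 2 powr (j / 2) = (SUP x. \<bar>\<phi> x\<bar>) + (SUP x. \<bar>\<psi> x\<bar>)"
    using True by (simp add: wbound_def powr_minus powr_half_sqrt[symmetric] field_simps)
  show ?thesis
    unfolding e using True abs_le_SUP[OF bounded_phi, of "x - k"] SUP_abs_nonneg[OF bounded_psi]
    by (simp add: wav_def)
next
  case False
  have "\<bar>\<psi> y\<bar> \<le> wbound" for y
  proof -
    have "\<bar>\<psi> y\<bar> \<le> (SUP x. \<bar>\<phi> x\<bar>) + (SUP x. \<bar>\<psi> x\<bar>)"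
      using abs_le_SUP[OF bounded_psi, of y] SUP_abs_nonneg[OF bounded_phi] by simp
    also have "\<dots> \<le> wbound"
      unfolding wbound_def
      using SUP_abs_nonneg[OF bounded_phi] SUP_abs_nonneg[OF bounded_psi]
        mult_right_mono[of 1 "sqrt 2" "(SUP x. \<bar>\<phi> x\<bar>) + (SUP x. \<bar>\<psi> x\<bar>)"] by simp
    finally show ?thesis .
  qed
  then show ?thesis using False by (simp add: wav_def abs_mult mult.commute mult_left_mono)
qed

lemma wav_eq_0:
  assumes "A < \<bar>scale j * x - of_int k\<bar>"
  shows "w j k x = 0"
proof -
  have "scale j * x - of_int k \<notin> {-A..A}" using assms by auto
  then show ?thesis using phi_eq_0 psi_eq_0 by (auto simp: wav_def scale_def)
qed

lemma wav_neq_0D: "w j k x \<noteq> 0 \<Longrightarrow> \<bar>scale j * x - of_int k\<bar> \<le> A"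
  using wav_eq_0[of j x k] by (auto simp: not_less[symmetric])

text \<open>The support of \<open>w j k\<close> lies where
  \<open>\<bar>scale j * x - of_int k\<bar> \<le> A\<close>, so every translate that does not vanish
  identically on \<open>[-B, B]\<close> has its index in this finite set.\<close>

definition window :: "real \<Rightarrow> int \<Rightarrow> int set" where
  "window B j = {k. \<bar>of_int k\<bar> \<le> scale j * B + A}"

lemma window_finite [simp]: "finite (window B j)"
proof (rule finite_subset)
  show "window B j \<subseteq> {\<lfloor>- (scale j * B + A)\<rfloor>..\<lceil>scale j * B + A\<rceil>}"
    by (auto simp: window_def) linarith+
qed simp

lemma wav_eq_0_window:
  assumes "j \<ge> -1" "\<bar>x\<bar> \<le> B" "k \<notin> window B j"
  shows "w j k x = 0"
proof (rule wav_eq_0)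
  have "scale j * \<bar>x\<bar> \<le> scale j * B"
    using scale_ge_1[OF assms(1)] assms(2) by (intro mult_left_mono) auto
  then have "\<bar>scale j * x\<bar> \<le> scale j * B"
    using scale_ge_1[OF assms(1)] by (simp add: abs_mult)
  then show "A < \<bar>scale j * x - of_int k\<bar>"
    using assms(3) by (auto simp: window_def)
qed

text \<open>Since \<open>scale j \<ge> 1\<close>, the overhang \<open>2 * A / scale j\<close> is at
  most \<open>2 * A\<close>. The radius is the same at every level, so a series over windows has
  compact support.\<close>

lemma window_supp:
  assumes "j \<ge> -1" "k \<in> window B j" "w j k x \<noteq> 0" "0 \<le> B"
  shows "\<bar>x\<bar> \<le> B + 2 * A"
proof -
  have "\<bar>scale j * x\<bar> \<le> scale j * B + 2 * A"
    using wav_neq_0D[OF assms(3)] assms(2) by (auto simp: window_def)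
  then have "scale j * \<bar>x\<bar> \<le> scale j * B + 2 * A"
    using scale_ge_1[OF assms(1)] by (simp add: abs_mult)
  also have "\<dots> \<le> scale j * (B + 2 * A)"
    using scale_ge_1[OF assms(1)] A_pos by (simp add: distrib_left)
  finally show ?thesis using scale_ge_1[OF assms(1)] by simp
qed

text \<open>Only indices within distance \<open>A\<close> of \<open>scale j * x\<close> contribute,
  and there are at most \<open>2 * A + 1\<close> of them, whatever \<open>F\<close> is.\<close>

lemma sum_abs_wav_le:
  assumes "j \<ge> -1" "finite F"
  shows "(\<Sum>k\<in>F. \<bar>w j k x\<bar>) \<le> (2 * A + 1) * wbound * 2 powr (j / 2)"
proof -
  define S where "S = {k::int. scale j * x - A \<le> of_int k \<and> of_int k \<le> scale j * x + A}"
  have S: "finite S" "card S \<le> 2 * A + 1"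
    using card_int_interval_le[of "scale j * x - A" "scale j * x + A"] A_pos by (auto simp: S_def)
  have "w j k x = 0" if "k \<notin> S" for k
    using that by (intro wav_eq_0) (auto simp: S_def)
  then have "(\<Sum>k\<in>F. \<bar>w j k x\<bar>) = (\<Sum>k\<in>F \<inter> S. \<bar>w j k x\<bar>)"
    using assms(2) by (intro sum.mono_neutral_right) auto
  also have "\<dots> \<le> (\<Sum>k\<in>F \<inter> S. wbound * 2 powr (j / 2))"
    by (intro sum_mono wav_le assms)
  also have "\<dots> = card (F \<inter> S) * (wbound * 2 powr (j / 2))" by simp
  also have "\<dots> \<le> card S * (wbound * 2 powr (j / 2))"
    using S wbound_nonneg by (intro mult_right_mono of_nat_mono card_mono) auto
  also have "\<dots> \<le> (2 * A + 1) * (wbound * 2 powr (j / 2))"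
    using S wbound_nonneg by (intro mult_right_mono) auto
  finally show ?thesis by (simp add: mult.assoc)
qed

lemma level_le:
  assumes "j \<ge> -1" "finite F" "\<And>k. k \<in> F \<Longrightarrow> \<bar>a k\<bar> \<le> b" "0 \<le> b"
  shows "\<bar>\<Sum>k\<in>F. a k * w j k x\<bar> \<le> b * ((2 * A + 1) * wbound * 2 powr (j / 2))"
proof -
  have "\<bar>\<Sum>k\<in>F. a k * w j k x\<bar> \<le> (\<Sum>k\<in>F. \<bar>a k\<bar> * \<bar>w j k x\<bar>)"
    by (rule order_trans[OF sum_abs]) (simp add: abs_mult)
  also have "\<dots> \<le> (\<Sum>k\<in>F. b * \<bar>w j k x\<bar>)"
    using assms by (intro sum_mono mult_right_mono) auto
  also have "\<dots> = b * (\<Sum>k\<in>F. \<bar>w j k x\<bar>)" by (simp add: sum_distrib_left)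
  also have "\<dots> \<le> b * ((2 * A + 1) * wbound * 2 powr (j / 2))"
    using assms by (intro mult_left_mono sum_abs_wav_le)
  finally show ?thesis .
qed

lemma square_integrable_wav: "j \<ge> -1 \<Longrightarrow> square_integrable (w j k)"
  using orthonormal_basis unfolding orthonormal_basis_L2_def by auto

lemma orthonormal_wav:
  assumes "j \<ge> -1" "j' \<ge> -1"
  shows "(LBINT x. w j k x * w j' k' x) = (if j = j' \<and> k = k' then 1 else 0)"
  using orthonormal_basis assms unfolding orthonormal_basis_L2_def by (auto split: prod.splits)

lemma wav_supp:
  assumes "j \<ge> -1" "w j k x \<noteq> 0"
  shows "\<bar>x\<bar> \<le> \<bar>of_int k\<bar> + 2 * A"
proof (rule window_supp[OF assms(1) _ assms(2)])
  show "k \<in> window \<bar>of_int k\<bar> j"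
    using scale_ge_1[OF assms(1)] A_pos mult_right_mono[of 1 "scale j" "\<bar>of_int k\<bar>"]
    by (auto simp: window_def)
qed simp

lemma integrable_wav: "j \<ge> -1 \<Longrightarrow> integrable lborel (w j k)"
  by (rule integrable_bounded_support[OF wav_measurable wav_le wav_supp])

lemma integrable_mult_wav:
  "j \<ge> -1 \<Longrightarrow> integrable lborel h \<Longrightarrow> integrable lborel (\<lambda>x. h x * w j k x)"
  by (rule integrable_mult_bounded[OF _ wav_measurable wav_le])

end

section \<open>Wavelet series and uniqueness of coefficients\<close>

text \<open>The shift \<open>l = j + 1\<close> turns sums over levels \<open>j \<ge> -1\<close> into
  ordinary series over the naturals; levels \<open>-1..J\<close> become the first
  \<open>J + 2\<close> terms.\<close>

lemma has_sum_levels_iff: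
  fixes e :: "int \<Rightarrow> real"
  shows "(e has_sum s) {-1..} \<longleftrightarrow> ((\<lambda>l::nat. e (int l - 1)) has_sum s) UNIV"
proof (rule has_sum_reindex_bij_witness[where i = "\<lambda>l. int l - 1" and j = "\<lambda>j. nat (j + 1)"])
qed auto

lemma sum_levels:
  fixes e :: "int \<Rightarrow> real"
  shows "(\<Sum>j\<in>{-1..int J}. e j) = (\<Sum>l<J + 2. e (int l - 1))"
  by (rule sum.reindex_bij_witness[where i = "\<lambda>l. int l - 1" and j = "\<lambda>j. nat (j + 1)"]) auto

text \<open>Decay faster than \<open>2 powr (- j / 2)\<close> beats the growth of the wavelets and
  makes the series converge uniformly. Two instances occur: Lipschitz functions with
  \<open>\<gamma> = 3 / 2\<close>, and Sobolev densities with
  \<open>\<gamma> = \<beta>\<close>.\<close>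

locale wavelet_series = compact_wavelet +
  fixes a :: "int \<Rightarrow> int \<Rightarrow> real" and F :: "int \<Rightarrow> int set" and c \<gamma> B :: real
  assumes gamma: "\<gamma> > 1 / 2" and B_nonneg: "0 \<le> B"
    and F_subset: "\<And>j. F j \<subseteq> window B j"
    and coeff_le: "\<And>j k. j \<ge> -1 \<Longrightarrow> k \<in> F j \<Longrightarrow> \<bar>a j k\<bar> \<le> c * 2 powr (- \<gamma> * j)"
    and c_nonneg: "0 \<le> c"
begin

definition lev :: "nat \<Rightarrow> real \<Rightarrow> real" where
  "lev l x = (\<Sum>k\<in>F (int l - 1). a (int l - 1) k * w (int l - 1) k x)"

text \<open>Ratio of the geometric series dominating the levels: wavelet size
  \<open>2 powr (j / 2)\<close> times coefficient size
  \<open>2 powr (- \<gamma> * j)\<close>.\<close>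

definition q :: real where "q = 2 powr (1 / 2 - \<gamma>)"

text \<open>The division by \<open>q\<close> compensates the index shift: level
  \<open>j = l - 1\<close> has size \<open>q powr j = q ^ l / q\<close>.\<close>

definition gconst :: real where "gconst = c * (2 * A + 1) * wbound / q"

definition g :: "real \<Rightarrow> real" where "g x = (\<Sum>l. lev l x)"

lemma finite_F [simp]: "finite (F j)"
  using F_subset window_finite finite_subset by blast

lemma q: "0 < q" "q < 1"
  using gamma by (auto simp: q_def intro!: powr_less_one)

lemma gconst_nonneg: "0 \<le> gconst"
  using c_nonneg A_pos wbound_nonneg q by (auto simp: gconst_def)

lemma lev_measurable [measurable]: "lev l \<in> borel_measurable borel"
  unfolding lev_def by measurable

lemma lev_le: "\<bar>lev l x\<bar> \<le> gconst * q ^ l"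
proof -
  let ?j = "int l - 1"
  have "\<bar>lev l x\<bar> \<le> c * 2 powr (- \<gamma> * ?j) * ((2 * A + 1) * wbound * 2 powr (?j / 2))"
    unfolding lev_def using c_nonneg by (intro level_le coeff_le) auto
  also have "\<dots> = c * (2 * A + 1) * wbound * (2 powr (- \<gamma> * ?j) * 2 powr (?j / 2))"
    by (simp only: mult_ac)
  also have "2 powr (- \<gamma> * ?j) * 2 powr (?j / 2) = 2 powr ((1 / 2 - \<gamma>) * (real l - 1))"
    by (simp add: algebra_simps add_divide_distrib flip: powr_add)
  also have "\<dots> = q powr (real l - 1)" by (simp add: q_def powr_powr)
  also have "\<dots> = q ^ l / q" using q by (simp add: powr_diff powr_realpow)
  finally show ?thesis by (simp add: gconst_def)
qed

lemma summable_geometric_bound: "summable (\<lambda>l. gconst * q ^ l)"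
  using q by (intro summable_mult summable_geometric) auto

lemma summable_abs_lev: "summable (\<lambda>l. norm (lev l x))"
  using lev_le by (intro summable_comparison_test'[OF summable_geometric_bound]) auto

lemma lev_sums_g: "(\<lambda>l. lev l x) sums g x"
  using summable_norm_cancel[OF summable_abs_lev] unfolding g_def by (rule summable_sums)

lemma has_sum_g: "((\<lambda>j. \<Sum>k\<in>F j. a j k * w j k x) has_sum g x) {-1..}"
  using norm_summable_imp_has_sum[OF summable_abs_lev lev_sums_g]
  by (simp add: has_sum_levels_iff lev_def)

text \<open>Removing the first \<open>J + 2\<close> terms leaves a geometric tail. The limit is an
  arbitrary \<open>s\<close>, so the bound can be applied to a value \<open>f x\<close> at any point
  where the series sums to it.\<close>

lemma tail_le:
  assumes "((\<lambda>j. \<Sum>k\<in>F j. a j k * w j k x) has_sum s) {-1..}"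
  shows "\<bar>s - (\<Sum>j\<in>{-1..int J}. \<Sum>k\<in>F j. a j k * w j k x)\<bar> \<le> gconst / (1 - q) * q ^ (J + 2)"
proof -
  have s: "(\<lambda>l. lev l x) sums s"
    using has_sum_imp_sums assms unfolding has_sum_levels_iff by (simp add: lev_def)
  have sm: "summable (\<lambda>l. norm (lev (l + (J + 2)) x))"
    using summable_abs_lev by (subst summable_iff_shift)
  have "s - (\<Sum>j\<in>{-1..int J}. \<Sum>k\<in>F j. a j k * w j k x) = (\<Sum>l. lev (l + (J + 2)) x)"
    using suminf_minus_initial_segment[OF sums_summable[OF s], of "J + 2"] s
    unfolding sum_levels by (simp add: lev_def sums_iff)
  also have "\<bar>\<dots>\<bar> \<le> (\<Sum>l. norm (lev (l + (J + 2)) x))"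
    using summable_norm[OF sm] by simp
  also have "\<dots> \<le> (\<Sum>l. gconst * q ^ (J + 2) * q ^ l)"
  proof (rule suminf_le[OF _ sm])
    show "norm (lev (l + (J + 2)) x) \<le> gconst * q ^ (J + 2) * q ^ l" for l
      using lev_le[of "l + (J + 2)" x] by (simp add: power_add mult_ac)
    show "summable (\<lambda>l. gconst * q ^ (J + 2) * q ^ l)"
      using q by (intro summable_mult summable_geometric) auto
  qed
  also have "\<dots> = gconst * q ^ (J + 2) * (1 / (1 - q))"
    using q by (subst suminf_mult) (auto simp: suminf_geometric intro!: summable_geometric)
  finally show ?thesis by simp
qed

lemma g_le: "\<bar>g x\<bar> \<le> gconst / (1 - q)"
proof -
  have "\<bar>g x\<bar> \<le> (\<Sum>l. norm (lev l x))"
    unfolding g_def using summable_norm[OF summable_abs_lev] by simp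
  also have "\<dots> \<le> (\<Sum>l. gconst * q ^ l)"
    using lev_le by (intro suminf_le summable_abs_lev summable_geometric_bound) auto
  also have "\<dots> = gconst * (1 / (1 - q))"
    using q by (subst suminf_mult) (auto simp: suminf_geometric intro!: summable_geometric)
  finally show ?thesis by simp
qed

lemma g_supp:
  assumes "g x \<noteq> 0"
  shows "\<bar>x\<bar> \<le> B + 2 * A"
proof (rule ccontr)
  assume *: "\<not> ?thesis"
  have "lev l x = 0" for l
    unfolding lev_def
  proof (intro sum.neutral ballI)
    fix k assume "k \<in> F (int l - 1)"
    then have "w (int l - 1) k x = 0"
      using window_supp[of "int l - 1" k B x] F_subset B_nonneg * by auto
    then show "a (int l - 1) k * w (int l - 1) k x = 0" by simp
  qed
  then show False using assms by (simp add: g_def)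
qed

lemma g_measurable [measurable]: "g \<in> borel_measurable borel"
  unfolding g_def by measurable

lemma integrable_g: "integrable lborel g"
  by (rule integrable_bounded_support[OF g_measurable g_le g_supp])

lemma square_integrable_g: "square_integrable g"
  by (rule square_integrable_bounded_support[OF g_measurable g_le g_supp])

text \<open>The bound \<open>gconst * q ^ l\<close> on level \<open>l\<close> is uniform in
  \<open>x\<close>, so integrability of \<open>h\<close> alone justifies termwise integration.
  Taking a wavelet for \<open>h\<close> recovers the coefficients of \<open>g\<close>; taking an
  \<open>h\<close> with vanishing coefficients shows that it is orthogonal to
  \<open>g\<close>.\<close>

lemma integral_mult_g_sums:
  assumes h: "integrable lborel h"
  shows "(\<lambda>l. \<Sum>k\<in>F (int l - 1). a (int l - 1) k * (LBINT x. h x * w (int l - 1) k x))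
    sums (LBINT x. h x * g x)"
proof -
  have *: "(LBINT x. h x * lev l x) =
      (\<Sum>k\<in>F (int l - 1). a (int l - 1) k * (LBINT x. h x * w (int l - 1) k x))" for l
  proof -
    have "(LBINT x. h x * lev l x) =
        (LBINT x. \<Sum>k\<in>F (int l - 1). a (int l - 1) k * (h x * w (int l - 1) k x))"
      by (simp add: lev_def sum_distrib_left mult_ac)
    also have "\<dots> = (\<Sum>k\<in>F (int l - 1). LBINT x. a (int l - 1) k * (h x * w (int l - 1) k x))"
      using h by (intro Bochner_Integration.integral_sum integrable_mult_right integrable_mult_wav) auto
    finally show ?thesis by simp
  qed
  have "(\<lambda>l. LBINT x. h x * lev l x) sums (LBINT x. \<Sum>l. h x * lev l x)"
  proof (rule sums_integral)
    show int: "integrable lborel (\<lambda>x. h x * lev l x)" for l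
      by (rule integrable_mult_bounded[OF h lev_measurable lev_le])
    show "AE x in lborel. summable (\<lambda>l. norm (h x * lev l x))"
      using summable_abs_lev by (auto simp: norm_mult abs_mult intro!: summable_mult)
    show "summable (\<lambda>l. LBINT x. norm (h x * lev l x))"
    proof (rule summable_comparison_test')
      show "summable (\<lambda>l. (LBINT x. norm (h x)) * (gconst * q ^ l))"
        by (intro summable_mult summable_geometric_bound)
      fix l
      have "(LBINT x. norm (h x * lev l x)) \<le> (LBINT x. norm (h x) * (gconst * q ^ l))"
      proof (rule integral_mono)
        show "integrable lborel (\<lambda>x. norm (h x * lev l x))" using int by (rule integrable_norm)
        show "integrable lborel (\<lambda>x. norm (h x) * (gconst * q ^ l))" using h by simp
        show "norm (h x * lev l x) \<le> norm (h x) * (gconst * q ^ l)" for x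
          using lev_le by (auto simp: abs_mult intro!: mult_left_mono)
      qed
      then show "norm (LBINT x. norm (h x * lev l x)) \<le> (LBINT x. norm (h x)) * (gconst * q ^ l)"
        by simp
    qed
  qed
  moreover have "(\<lambda>x. \<Sum>l. h x * lev l x) = (\<lambda>x. h x * g x)"
    using summable_norm_cancel[OF summable_abs_lev] by (simp add: g_def suminf_mult fun_eq_iff)
  ultimately show ?thesis by (simp add: *)
qed

lemma coeff_g:
  assumes "j \<ge> -1"
  shows "(LBINT x. g x * w j k x) = (if k \<in> F j then a j k else 0)"
proof -
  let ?t = "if k \<in> F j then a j k else 0"
  \<comment> \<open>By orthonormality the whole series collapses to the single term at
    \<open>l = j + 1\<close> and \<open>k' = k\<close>.\<close>
  have eq: "(\<Sum>k'\<in>F (int l - 1). a (int l - 1) k' * (LBINT x. w j k x * w (int l - 1) k' x)) =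
      (if l = nat (j + 1) then ?t else 0)" for l
  proof -
    have "(\<Sum>k'\<in>F (int l - 1). a (int l - 1) k' * (LBINT x. w j k x * w (int l - 1) k' x)) =
        (\<Sum>k'\<in>F (int l - 1). if k' = k then (if int l - 1 = j then a j k else 0) else 0)"
      using assms by (intro sum.cong) (auto simp: orthonormal_wav)
    also have "\<dots> = (if l = nat (j + 1) then ?t else 0)"
      using assms by (auto simp: sum.delta)
    finally show ?thesis .
  qed
  have "(\<lambda>l. if l = nat (j + 1) then ?t else 0) sums (LBINT x. w j k x * g x)"
    using integral_mult_g_sums[OF integrable_wav[OF assms, of k]] unfolding eq .
  moreover have "(\<lambda>l. if l = nat (j + 1) then ?t else 0) sums ?t"
    using sums_single[of "nat (j + 1)" "\<lambda>_. ?t"] by simp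
  ultimately show ?thesis by (simp add: sums_iff mult.commute)
qed

end

section \<open>Uniqueness of wavelet coefficients, first in \<open>L\<^sup>2\<close> and then in
  \<open>L\<^sup>1\<close>\<close>

context compact_wavelet
begin

text \<open>The basis property gives a finite wavelet combination \<open>p\<close> close to
  \<open>v\<close>. As \<open>v\<close> is orthogonal to \<open>p\<close>, the cross term vanishes
  and \<open>\<integral>v^2 \<le> \<integral>(v - p)^2 < \<delta>\<close>.\<close>

lemma AE_zero_if_coeffs_zero_L2:
  assumes v: "square_integrable v"
    and orth: "\<And>j k. j \<ge> -1 \<Longrightarrow> (LBINT x. v x * w j k x) = 0"
  shows "AE x in lborel. v x = 0"
proof -
  have v2: "integrable lborel (\<lambda>x. (v x)\<^sup>2)" using v by (simp add: square_integrable_def)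
  have "(LBINT x. (v x)\<^sup>2) \<le> 0 + \<delta>" if "\<delta> > 0" for \<delta>
  proof -
    obtain S cc where S: "finite S" "S \<subseteq> {-1..} \<times> UNIV"
      and less: "(LBINT x. (v x - (\<Sum>i\<in>S. cc i * (case i of (j, k) \<Rightarrow> w j k) x))\<^sup>2) < \<delta>"
      using orthonormal_basis v \<open>\<delta> > 0\<close> unfolding orthonormal_basis_L2_def by blast
    define p where "p x = (\<Sum>i\<in>S. cc i * w (fst i) (snd i) x)" for x
    have S': "fst i \<ge> -1" if "i \<in> S" for i using S that by auto
    have int: "integrable lborel (\<lambda>x. cc i * (v x * w (fst i) (snd i) x))" if "i \<in> S" for i
      using S'[OF that] v by (intro integrable_mult_right square_integrable_mult square_integrable_wav)
    have vp: "(\<lambda>x. v x * p x) = (\<lambda>x. \<Sum>i\<in>S. cc i * (v x * w (fst i) (snd i) x))"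
      by (simp add: p_def sum_distrib_left mult_ac fun_eq_iff)
    have ivp: "integrable lborel (\<lambda>x. v x * p x)" unfolding vp using int by auto
    have vp0: "(LBINT x. v x * p x) = 0"
      unfolding vp using int S' by (subst Bochner_Integration.integral_sum) (auto simp: orth)
    have p2: "integrable lborel (\<lambda>x. (p x)\<^sup>2)"
    proof -
      have "integrable lborel (\<lambda>x. \<Sum>i\<in>S. \<Sum>i'\<in>S. cc i * cc i' * (w (fst i) (snd i) x * w (fst i') (snd i') x))"
        using S' by (intro Bochner_Integration.integrable_sum integrable_mult_right square_integrable_mult square_integrable_wav) auto
      then show ?thesis by (simp add: p_def power2_eq_square sum_product mult_ac)
    qed
    have "(LBINT x. (v x)\<^sup>2) \<le> (LBINT x. (v x)\<^sup>2) + (LBINT x. (p x)\<^sup>2)" by simp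
    also have "\<dots> = (LBINT x. (v x)\<^sup>2 + (p x)\<^sup>2 - 2 * (v x * p x))"
      using v2 p2 ivp vp0 by simp
    also have "\<dots> = (LBINT x. (v x - p x)\<^sup>2)" by (simp add: power2_diff mult.assoc)
    also have "\<dots> < \<delta>" using less by (simp add: p_def case_prod_unfold)
    finally show ?thesis by simp
  qed
  then have "(LBINT x. (v x)\<^sup>2) \<le> 0" by (rule field_le_epsilon)
  then have "(LBINT x. (v x)\<^sup>2) = 0" by (simp add: antisym)
  then show ?thesis
    using integral_nonneg_eq_0_iff_AE[OF v2] by simp
qed

lemma integral_wav_0:
  assumes "j \<ge> 0"
  shows "(LBINT x. w j k x) = 0"
proof -
  have "(LBINT y. \<psi> y) = \<bar>2 powr j\<bar> *\<^sub>R (LBINT x. \<psi> (- of_int k + 2 powr j * x))"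
    by (rule lborel_integral_real_affine) simp
  then have "(LBINT x. \<psi> (2 powr j * x - of_int k)) = 0" using integral_psi by simp
  then show ?thesis using assms by (simp add: wav_def)
qed

text \<open>The vanishing moment \<open>\<integral>\<psi> = 0\<close> gains a factor \<open>2 powr (- j)\<close> over the trivial bound, which
  makes the wavelet series of Lipschitz functions converge uniformly.\<close>

lemma coeff_Lipschitz_le:
  assumes u: "u \<in> borel_measurable borel" "\<And>x y. \<bar>u x - u y\<bar> \<le> L * \<bar>x - y\<bar>"
    and "\<And>x. \<bar>u x\<bar> \<le> 1" "0 \<le> L" "j \<ge> -1" and supp: "\<And>x. u x \<noteq> 0 \<Longrightarrow> \<bar>x\<bar> \<le> B"
  shows "\<bar>LBINT x. u x * w j k x\<bar> \<le> 2 * A * (L * A + 1) * wbound * 2 powr (- (3 / 2) * j)"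
proof -
  let ?I = "{(of_int k - A) / scale j .. (of_int k + A) / scale j}"
  have sc: "scale j > 0" using scale_ge_1[OF \<open>j \<ge> -1\<close>] by simp
  have measI: "measure lborel ?I = 2 * A / scale j"
    using A_pos sc by (subst measure_lborel_Icc) (auto simp: divide_right_mono field_simps)
  \<comment> \<open>The trivial bound: sup of \<open>v\<close> on the support interval, times sup of
    the wavelet, times interval length. It is used for \<open>v = u\<close> at level
    \<open>-1\<close> and for \<open>v = u - u x0\<close> at all higher levels.\<close>
  have key: "\<bar>LBINT x. v x * w j k x\<bar> \<le> b * (wbound * 2 powr (j / 2)) * (2 * A / scale j)"
    if v: "v \<in> borel_measurable borel" "\<And>x. x \<in> ?I \<Longrightarrow> \<bar>v x\<bar> \<le> b" "0 \<le> b"  for v :: "real \<Rightarrow> real" and b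
  proof -
    have "\<bar>v x * w j k x\<bar> \<le> b * (wbound * 2 powr (j / 2)) * indicator ?I x" for x
    proof (cases "w j k x = 0")
      case True
      then show ?thesis using wbound_nonneg v(3) by auto
    next
      case False
      then have "x \<in> ?I" using wav_neq_0D[of j k x] sc by (auto simp: field_simps abs_le_iff)
      then show ?thesis
        using v wav_le[OF \<open>j \<ge> -1\<close>, of k x] by (auto simp: abs_mult intro!: mult_mono)
    qed
    then have dom: "norm (v x * w j k x) \<le> b * (wbound * 2 powr (j / 2)) * indicator ?I x" for x
      by simp
    have iI: "integrable lborel (\<lambda>x. b * (wbound * 2 powr (j / 2)) * indicator ?I x)"
      by (intro integrable_mult_right integrable_real_indicator) (auto simp: emeasure_lborel_Icc_eq)
    have iv: "integrable lborel (\<lambda>x. v x * w j k x)"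
    proof (rule Bochner_Integration.integrable_bound[OF iI])
      show "(\<lambda>x. v x * w j k x) \<in> borel_measurable lborel" using v(1) by measurable
      show "AE x in lborel. norm (v x * w j k x) \<le> norm (b * (wbound * 2 powr (j / 2)) * indicator ?I x)"
        by (rule AE_I2) (metis dom abs_ge_self order_trans real_norm_def)
    qed
    have "\<bar>LBINT x. v x * w j k x\<bar> \<le> (LBINT x. \<bar>v x * w j k x\<bar>)"
      by (rule integral_abs_bound)
    also have "\<dots> \<le> (LBINT x. b * (wbound * 2 powr (j / 2)) * indicator ?I x)"
      using iI iv dom by (intro integral_mono) auto
    also have "\<dots> = b * (wbound * 2 powr (j / 2)) * (2 * A / scale j)"
      using measI by simp
    finally show ?thesis .
  qed
  show ?thesis
  proof (cases "j = -1")
    case True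
    have "\<bar>LBINT x. u x * w j k x\<bar> \<le> 1 * (wbound * 2 powr (j / 2)) * (2 * A / scale j)"
      using assms by (intro key) auto
    also have "\<dots> = 2 * A * 1 * wbound * 2 powr (j / 2)"
      using True by (simp add: scale_def)
    also have "\<dots> \<le> 2 * A * (L * A + 1) * wbound * 2 powr (- (3 / 2) * j)"
      using A_pos wbound_nonneg \<open>0 \<le> L\<close> True by (intro mult_mono) auto
    finally show ?thesis .
  next
    case False
    then have "j \<ge> 0" using \<open>j \<ge> -1\<close> by simp
    \<comment> \<open>The centre of \<open>?I\<close>. Subtracting the constant \<open>u x0\<close>
      leaves the integral unchanged since the wavelet has mean zero, and the Lipschitz condition
      makes the difference of size \<open>L * A / scale j\<close> on \<open>?I\<close>.\<close>
    define x0 where "x0 = of_int k / scale j"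
    have intu: "integrable lborel (\<lambda>x. u x * w j k x)"
      using assms by (intro integrable_mult_wav integrable_bounded_support[where b = 1 and B = B]) auto
    have "(LBINT x. (u x - u x0) * w j k x) = (LBINT x. u x * w j k x) - u x0 * (LBINT x. w j k x)"
      using intu integrable_wav[OF \<open>j \<ge> -1\<close>, of k] by (simp add: left_diff_distrib)
    then have "\<bar>LBINT x. u x * w j k x\<bar> = \<bar>LBINT x. (u x - u x0) * w j k x\<bar>"
      using integral_wav_0[OF \<open>j \<ge> 0\<close>] by simp
    also have "\<dots> \<le> (L * (A / scale j)) * (wbound * 2 powr (j / 2)) * (2 * A / scale j)"
    proof (rule key)
      fix x assume x: "x \<in> ?I"
      then have "\<bar>x - x0\<bar> \<le> A / scale j"
        unfolding x0_def by (auto simp: abs_le_iff diff_divide_distrib add_divide_distrib)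
      then show "\<bar>u x - u x0\<bar> \<le> L * (A / scale j)"
        using u(2)[of x x0] \<open>0 \<le> L\<close> by (meson mult_left_mono order_trans)
    qed (use u A_pos sc \<open>0 \<le> L\<close> in auto)
    also have "\<dots> = 2 * A * (L * A) * wbound * (2 powr (j / 2) / scale j / scale j)"
      using sc by (simp add: field_simps)
    also have "2 powr (j / 2) / scale j / scale j = 2 powr (- (3 / 2) * j)"
      using False by (simp add: scale_def flip: powr_diff)
    also have "2 * A * (L * A) * wbound * 2 powr (- (3 / 2) * j)
        \<le> 2 * A * (L * A + 1) * wbound * 2 powr (- (3 / 2) * j)"
      using A_pos wbound_nonneg \<open>0 \<le> L\<close> by (intro mult_right_mono mult_left_mono) auto
    finally show ?thesis .
  qed
qed

text \<open>The coefficients of \<open>u\<close> decay like \<open>2 powr (- (3 / 2) * j)\<close>,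
  so their series \<open>s.g\<close> converges uniformly. The difference of \<open>u\<close> and
  \<open>s.g\<close> is square integrable with zero coefficients, hence \<open>u\<close> equals
  \<open>s.g\<close> almost everywhere, and \<open>h\<close> can be integrated against
  \<open>s.g\<close> term by term.\<close>

lemma integral_Lipschitz_zero:
  assumes h: "integrable lborel h" "\<And>j k. j \<ge> -1 \<Longrightarrow> (LBINT x. h x * w j k x) = 0"
    and u: "u \<in> borel_measurable borel" "\<And>x y. \<bar>u x - u y\<bar> \<le> L * \<bar>x - y\<bar>"
      "\<And>x. \<bar>u x\<bar> \<le> 1" "0 \<le> L" and supp: "\<And>x. u x \<noteq> 0 \<Longrightarrow> \<bar>x\<bar> \<le> B" and "0 \<le> B"
  shows "(LBINT x. h x * u x) = 0"
proof -
  define a where "a j k = (LBINT x. u x * w j k x)" for j k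
  interpret s: wavelet_series A \<phi> \<psi> a "window B" "2 * A * (L * A + 1) * wbound" "3 / 2" B
  proof
    show "\<bar>a j k\<bar> \<le> 2 * A * (L * A + 1) * wbound * 2 powr (- (3 / 2) * j)" if "j \<ge> -1" for j k
      unfolding a_def using assms that by (intro coeff_Lipschitz_le) auto
    show "0 \<le> 2 * A * (L * A + 1) * wbound"
      using A_pos wbound_nonneg u(4) by simp
  qed (use \<open>0 \<le> B\<close> in auto)
  have iu: "integrable lborel u" using u supp by (intro integrable_bounded_support[where b = 1 and B = B])
  have a0: "a j k = 0" if "j \<ge> -1" "k \<notin> window B j" for j k
  proof -
    have "u x * w j k x = 0" for x
      using wav_eq_0_window[OF that(1) _ that(2), of x] supp[of x] by auto
    then have "(\<lambda>x. u x * w j k x) = (\<lambda>_. 0)" by blast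
    then show ?thesis by (simp add: a_def del: mult_eq_0_iff)
  qed
  have "AE x in lborel. u x - s.g x = 0"
  proof (rule AE_zero_if_coeffs_zero_L2)
    show "square_integrable (\<lambda>x. u x - s.g x)"
    proof (rule square_integrable_bounded_support)
      show "\<bar>u x - s.g x\<bar> \<le> 1 + s.gconst / (1 - s.q)" for x
        using u(3)[of x] s.g_le[of x] by linarith
      show "\<bar>x\<bar> \<le> B + 2 * A" if "u x - s.g x \<noteq> 0" for x
        using supp[of x] s.g_supp[of x] that A_pos by fastforce
    qed (use u in measurable)
    show "(LBINT x. (u x - s.g x) * w j k x) = 0" if "j \<ge> -1" for j k
    proof -
      have "(LBINT x. (u x - s.g x) * w j k x) = a j k - (LBINT x. s.g x * w j k x)"
        using Bochner_Integration.integral_diff[OF integrable_mult_wav[OF that iu]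
            integrable_mult_wav[OF that s.integrable_g], of k k]
        by (simp add: a_def left_diff_distrib)
      then show ?thesis using s.coeff_g[OF that] a0[OF that] by auto
    qed
  qed
  then have "(LBINT x. h x * u x) = (LBINT x. h x * s.g x)"
    using h(1) u(1) by (intro integral_cong_AE) auto
  also have "\<dots> = 0"
    using s.integral_mult_g_sums[OF h(1)] h(2) by (simp add: sums_iff)
  finally show ?thesis .
qed

text \<open>The indicator is a pointwise limit of compactly supported Lipschitz functions with
  values in \<open>[0, 1]\<close>; \<open>\<bar>h\<bar>\<close> dominates the products.\<close>

lemma integral_interval_zero:
  assumes h: "integrable lborel h" "\<And>j k. j \<ge> -1 \<Longrightarrow> (LBINT x. h x * w j k x) = 0"
  shows "(LBINT x. h x * indicator {a..b} x) = 0"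
proof -
  \<comment> \<open>For \<open>a \<le> b\<close> this is the distance to \<open>{a..b}\<close>. In
    every case it vanishes exactly on \<open>{a..b}\<close>, also when that interval is empty. The
    trapezoid \<open>u n\<close> is 1 where \<open>d\<close> vanishes and falls to 0 with slope
    \<open>Suc n\<close>.\<close>
  define d where "d x = max 0 (max (a - x) (x - b))" for x :: real
  define u where "u n x = max 0 (1 - real (Suc n) * d x)" for n x
  have d: "\<bar>d x - d y\<bar> \<le> \<bar>x - y\<bar>" "0 \<le> d x" for x y
    by (auto simp: d_def)
  have u01: "0 \<le> u n x" "u n x \<le> 1" for n x using d(2)[of x] by (auto simp: u_def)
  have zero: "(LBINT x. h x * u n x) = 0" for n
  proof (rule integral_Lipschitz_zero[OF h])
    show "u n \<in> borel_measurable borel" unfolding u_def d_def by measurable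
    show "\<bar>u n x - u n y\<bar> \<le> real (Suc n) * \<bar>x - y\<bar>" for x y
    proof -
      have "\<bar>u n x - u n y\<bar> \<le> \<bar>real (Suc n) * d x - real (Suc n) * d y\<bar>"
        unfolding u_def by linarith
      also have "\<dots> = real (Suc n) * \<bar>d x - d y\<bar>"
        by (simp only: abs_mult right_diff_distrib[symmetric] abs_of_nat)
      also have "\<dots> \<le> real (Suc n) * \<bar>x - y\<bar>" using d by (intro mult_left_mono) auto
      finally show ?thesis .
    qed
    show "\<bar>x\<bar> \<le> \<bar>a\<bar> + \<bar>b\<bar> + 1" if "u n x \<noteq> 0" for x
    proof -
      have "real (Suc n) * d x < 1" using that by (auto simp: u_def max_def split: if_splits)
      moreover have "1 * d x \<le> real (Suc n) * d x" using d(2)[of x] by (intro mult_right_mono) auto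
      ultimately have "d x < 1" by simp
      then show ?thesis unfolding d_def by (auto simp: abs_if)
    qed
    show "\<bar>u n x\<bar> \<le> 1" for x using u01[of n x] by simp
  qed auto
  have "(\<lambda>n. LBINT x. h x * u n x) \<longlonglongrightarrow> (LBINT x. h x * indicator {a..b} x)"
  proof (rule integral_dominated_convergence[where w = "\<lambda>x. \<bar>h x\<bar>"])
    show "AE x in lborel. (\<lambda>n. h x * u n x) \<longlonglongrightarrow> h x * indicator {a..b} x"
    proof (intro AE_I2 tendsto_mult tendsto_const)
      fix x
      show "(\<lambda>n. u n x) \<longlonglongrightarrow> indicator {a..b} x"
      proof (cases "d x = 0")
        case True
        then have "x \<in> {a..b}" by (auto simp: d_def max_def split: if_splits)
        then show ?thesis using True by (simp add: u_def)
      next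
        case False
        then have dp: "0 < d x" and x: "x \<notin> {a..b}" by (auto simp: d_def)
        obtain N where N: "1 / d x < real N" using reals_Archimedean2 by blast
        have "u n x = 0" if "n \<ge> N" for n
        proof -
          have "1 / d x < real (Suc n)" using N that by linarith
          then have "1 < real (Suc n) * d x" using dp by (simp add: field_simps)
          then show ?thesis by (simp add: u_def)
        qed
        then have "eventually (\<lambda>n. u n x = 0) sequentially"
          by (auto simp: eventually_sequentially)
        then show ?thesis using x by (simp add: tendsto_eventually)
      qed
    qed
    show "AE x in lborel. norm (h x * u n x) \<le> \<bar>h x\<bar>" for n
      using u01 by (intro AE_I2) (auto simp: abs_mult intro!: mult_left_le)
    show "integrable lborel (\<lambda>x. \<bar>h x\<bar>)" using h by simp
    show "(\<lambda>x. h x * indicator {a..b} x) \<in> borel_measurable lborel" using h by measurable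
    show "(\<lambda>x. h x * u n x) \<in> borel_measurable lborel" for n
      using h(1) unfolding u_def d_def by measurable
  qed
  then show ?thesis unfolding zero by (simp add: LIMSEQ_const_iff)
qed

text \<open>Uniqueness in \<open>L\<^sup>1\<close> does not follow from the basis property directly, since the basis
  expansion of a bounded test function need not converge boundedly; it does for Lipschitz ones.\<close>

lemma AE_zero_if_coeffs_zero:
  assumes h: "integrable lborel h" "\<And>j k. j \<ge> -1 \<Longrightarrow> (LBINT x. h x * w j k x) = 0"
  shows "AE x in lborel. h x = 0"
proof -
  have int: "integrable lborel (\<lambda>x. h x * indicator S x)" if "S \<in> sets borel" for S
    using h(1) that integrable_real_mult_indicator[of S lborel h] by simp
  \<comment> \<open>The integral over the whole line is needed for complements in the induction
    below; the intervals \<open>{- real n..real n}\<close> exhaust the line.\<close>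
  have total: "(LBINT x. h x) = 0"
  proof -
    have "(\<lambda>n. LBINT x. h x * indicator {- real n..real n} x) \<longlonglongrightarrow> (LBINT x. h x)"
    proof (rule integral_dominated_convergence[where w = "\<lambda>x. \<bar>h x\<bar>"])
      show "AE x in lborel. (\<lambda>n. h x * indicator {- real n..real n} x) \<longlonglongrightarrow> h x"
      proof (rule AE_I2)
        fix x
        obtain N where N: "\<bar>x\<bar> < real N" using reals_Archimedean2 by blast
        have "h x * indicator {- real n..real n} x = h x" if "n \<ge> N" for n
          using that N by (auto simp: indicator_def)
        then have "eventually (\<lambda>n. h x * indicator {- real n..real n} x = h x) sequentially"
          by (auto simp: eventually_sequentially)
        then show "(\<lambda>n. h x * indicator {- real n..real n} x) \<longlonglongrightarrow> h x"
          by (rule tendsto_eventually)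
      qed
      show "AE x in lborel. norm (h x * indicator {- real n..real n} x) \<le> \<bar>h x\<bar>" for n
        by (intro AE_I2) (auto simp: indicator_def)
    qed (use h int in auto)
    moreover have "(LBINT x. h x * indicator {- real n..real n} x) = 0" for n
      using h by (rule integral_interval_zero)
    ultimately show ?thesis by (simp add: LIMSEQ_const_iff)
  qed
  have "(LBINT x. h x * indicator S x) = 0" if S: "S \<in> sets borel" for S
  proof -
    \<comment> \<open>Closed intervals, empty ones included, form an intersection-stable generator
      of the Borel sets, so vanishing integrals extend from them to all Borel sets.\<close>
    let ?G = "range (\<lambda>(a, b). {a..b::real})"
    have sets_eq: "sigma_sets UNIV ?G = sets borel"
      by (subst borel_eq_atLeastAtMost) simp
    have "Int_stable ?G"
    proof (rule Int_stableI)
      fix s t assume "s \<in> ?G" "t \<in> ?G"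
      then obtain a b a' b' where "s = {a..b}" "t = {a'..b'}" by auto
      then have "s \<inter> t = (case (max a a', min b b') of (x, y) \<Rightarrow> {x..y})" by auto
      then show "s \<inter> t \<in> ?G" by blast
    qed
    moreover have "?G \<subseteq> Pow UNIV" by simp
    moreover have "S \<in> sigma_sets UNIV ?G" using S sets_eq by simp
    ultimately show ?thesis
    proof (induction rule: sigma_sets_induct_disjoint)
      case (basic S)
      then show ?case using integral_interval_zero[OF h] by auto
    next
      case empty
      then show ?case by simp
    next
      case (compl S)
      have "(\<lambda>x. h x * indicator (UNIV - S) x) = (\<lambda>x. h x - h x * indicator S x)"
        by (auto simp: indicator_def fun_eq_iff)
      then show ?case using compl int[of S] h(1) total sets_eq by simp
    next
      case (union S)
      have meas: "S i \<in> sets lborel" for i using union(2) sets_eq by auto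
      have "(LBINT x:(\<Union>i. S i). h x) = (\<Sum>i. LBINT x:S i. h x)"
      proof (rule lebesgue_integral_countable_add)
        show "set_integrable lborel (\<Union> (range S)) h"
          using meas int[of "\<Union>(range S)"] by (simp add: set_integrable_def mult.commute)
        show "S i \<inter> S j = {}" if "i \<noteq> j" for i j
          using union(1) that by (auto simp: disjoint_family_on_def)
      qed (use meas in auto)
      then show ?case using union(3) by (simp add: set_lebesgue_integral_def mult.commute)
    qed
  qed
  then have "AE x in lborel. h x = 0"
    using h(1) by (intro density_unique_real) (auto simp: set_lebesgue_integral_def mult.commute)
  then show ?thesis .
qed

section \<open>Active translates and the wavelet series of a Sobolev density\<close>

lemma active_subset: "j \<ge> -1 \<Longrightarrow> active \<phi> \<psi> j \<subseteq> window 1 j"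
proof
  fix k assume j: "j \<ge> -1" and "k \<in> active \<phi> \<psi> j"
  then obtain f where f: "\<And>x. x \<notin> {0..1} \<Longrightarrow> f x = 0" "wav_coeff \<phi> \<psi> f j k \<noteq> 0"
    unfolding active_def by blast
  show "k \<in> window 1 j"
  proof (rule ccontr)
    assume "k \<notin> window 1 j"
    then have "f x * w j k x = 0" for x
      using wav_eq_0_window[OF j, of x 1 k] f(1)[of x] by (cases "x \<in> {0..1}") auto
    then have "(\<lambda>x. f x * w j k x) = (\<lambda>_. 0)" by blast
    then show False using f(2) by (simp add: wav_coeff_def del: mult_eq_0_iff)
  qed
qed

lemma finite_active_level [simp]: "finite (active \<phi> \<psi> j)"
  using finite_active[OF wavelet_pair] .

text \<open>\<open>active\<close> tests only square integrable functions, while a density is just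
  integrable. Testing with the restriction \<open>v\<close> of the wavelet to \<open>[0, 1]\<close>
  yields the coefficient \<open>\<integral>v^2\<close>; if it is zero, the wavelet vanishes almost
  everywhere on \<open>[0, 1]\<close>, and so does its product with \<open>f\<close>.\<close>

lemma coeff_eq_0_not_active:
  assumes j: "j \<ge> -1" and k: "k \<notin> active \<phi> \<psi> j"
    and f: "f \<in> borel_measurable borel" "\<And>x. x \<notin> {0..1} \<Longrightarrow> f x = 0"
  shows "wav_coeff \<phi> \<psi> f j k = 0"
proof -
  define v where "v x = indicator {0..1} x * w j k x" for x :: real
  have v0: "v x = 0" if "x \<notin> {0..1}" for x using that by (simp add: v_def)
  have vm: "v \<in> borel_measurable borel" unfolding v_def by measurable
  have "\<bar>v x\<bar> \<le> wbound * 2 powr (j / 2)" for x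
    using wav_le[OF j, of k x] wbound_nonneg by (auto simp: v_def indicator_def)
  then have sq: "square_integrable v"
    by (rule square_integrable_bounded_support[OF vm, where B = 1]) (auto simp: v_def indicator_def)
  then have "wav_coeff \<phi> \<psi> v j k = 0"
    using k v0 unfolding active_def by blast
  moreover have "(\<lambda>x. v x * w j k x) = (\<lambda>x. (v x)\<^sup>2)"
    by (auto simp: v_def power2_eq_square indicator_def)
  ultimately have "(LBINT x. (v x)\<^sup>2) = 0" by (simp add: wav_coeff_def)
  then have "AE x in lborel. v x = 0"
    using integral_nonneg_eq_0_iff_AE[of lborel "\<lambda>x. (v x)\<^sup>2"] sq by (simp add: square_integrable_def)
  then have "AE x in lborel. f x * w j k x = 0"
    by eventually_elim (use f(2) in \<open>auto simp: v_def indicator_def split: if_splits\<close>)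
  then show ?thesis
    unfolding wav_coeff_def using f(1) by (intro integral_eq_zero_AE)
qed

text \<open>A single term of a sum of non-negative terms is at most the sum. The
  \<open>max R 0\<close> reflects that \<open>ennreal R\<close> is 0 for negative
  \<open>R\<close>.\<close>

lemma sobolev_coeff_le:
  assumes "sobolev_sum \<phi> \<psi> \<beta> f \<le> ennreal R" "j \<ge> -1" "k \<in> active \<phi> \<psi> j"
  shows "\<bar>wav_coeff \<phi> \<psi> f j k\<bar> \<le> sqrt (max R 0) * 2 powr (- \<beta> * j)"
proof -
  let ?e = "\<lambda>j::int. 2 powr (2 * of_int j * \<beta>) * (\<Sum>k\<in>active \<phi> \<psi> j. (wav_coeff \<phi> \<psi> f j k)\<^sup>2)"
  have "ennreal (?e j) = (\<Sum>\<^sub>\<infinity>j\<in>{j}. ennreal (?e j))" by simp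
  also have "\<dots> \<le> (\<Sum>\<^sub>\<infinity>j\<in>{-1..}. ennreal (?e j))"
    using assms(2) by (intro infsum_mono_neutral nonneg_summable_on_complete) auto
  also have "\<dots> \<le> ennreal (max R 0)"
    using assms(1) unfolding sobolev_sum_def by (rule order_trans) (simp add: ennreal_leI)
  finally have "?e j \<le> max R 0" by (subst (asm) ennreal_le_iff) auto
  have "2 powr (2 * of_int j * \<beta>) * (wav_coeff \<phi> \<psi> f j k)\<^sup>2 \<le> ?e j"
    using assms(3) by (intro mult_left_mono member_le_sum) auto
  also note \<open>?e j \<le> max R 0\<close>
  also have "2 powr (2 * of_int j * \<beta>) = (2 powr (\<beta> * j))\<^sup>2"
    by (simp add: power2_eq_square mult_ac flip: powr_add)
  finally have "(2 powr (\<beta> * j) * \<bar>wav_coeff \<phi> \<psi> f j k\<bar>)\<^sup>2 \<le> max R 0"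
    by (simp add: power_mult_distrib)
  then have "2 powr (\<beta> * j) * \<bar>wav_coeff \<phi> \<psi> f j k\<bar> \<le> sqrt (max R 0)"
    by (rule real_le_rsqrt)
  then show ?thesis by (simp add: powr_minus field_simps)
qed

text \<open>The series \<open>s.g\<close> built from the coefficients of \<open>f\<close> is
  integrable and has these same coefficients, so uniqueness in \<open>L\<^sup>1\<close> applies to
  the difference.\<close>

lemma sobolev_AE_wavelet_series:
  assumes f: "f \<in> sobolev_class \<phi> \<psi> \<beta>" and "\<beta> > 1 / 2"
  shows "AE x in lborel.
    ((\<lambda>j. \<Sum>k\<in>active \<phi> \<psi> j. wav_coeff \<phi> \<psi> f j k * w j k x) has_sum f x) {-1..}"
proof -
  have fm: "f \<in> borel_measurable borel" and f0: "\<And>x. 0 \<le> f x" "\<And>x. x \<notin> {0..1} \<Longrightarrow> f x = 0"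
    and f1: "(\<integral>\<^sup>+x. ennreal (f x) \<partial>lborel) = 1" and fin: "sobolev_sum \<phi> \<psi> \<beta> f < \<infinity>"
    using f by (auto simp: sobolev_class_def)
  have intf: "integrable lborel f"
    using fm f0 f1 by (intro integrableI_nonneg) auto
  obtain R where R: "sobolev_sum \<phi> \<psi> \<beta> f = ennreal R" "0 \<le> R"
    using fin by (cases "sobolev_sum \<phi> \<psi> \<beta> f") auto
  \<comment> \<open>The locale wants \<open>F j\<close> inside the window for every integer
    \<open>j\<close>, whereas \<open>active_subset\<close> covers \<open>j \<ge> -1\<close>; lower
    levels are therefore set to be empty.\<close>
  interpret s: wavelet_series A \<phi> \<psi> "wav_coeff \<phi> \<psi> f"
    "\<lambda>j. if j \<ge> -1 then active \<phi> \<psi> j else {}" "sqrt (max R 0)" \<beta> 1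
    using assms(2) active_subset R sobolev_coeff_le[of \<beta> f R] by unfold_locales auto
  have "AE x in lborel. f x - s.g x = 0"
  proof (rule AE_zero_if_coeffs_zero)
    show "integrable lborel (\<lambda>x. f x - s.g x)" using intf s.integrable_g by simp
    fix j k :: int assume j: "j \<ge> -1"
    have "(LBINT x. (f x - s.g x) * w j k x) = wav_coeff \<phi> \<psi> f j k - (LBINT x. s.g x * w j k x)"
      using Bochner_Integration.integral_diff[OF integrable_mult_wav[OF j intf]
          integrable_mult_wav[OF j s.integrable_g], of k k]
      by (simp add: wav_coeff_def left_diff_distrib)
    then show "(LBINT x. (f x - s.g x) * w j k x) = 0"
      using s.coeff_g[OF j] coeff_eq_0_not_active[OF j _ fm f0(2)] j by auto
  qed
  then show ?thesis
  proof eventually_elim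
    case (elim x)
    have "((\<lambda>j. \<Sum>k\<in>(if j \<ge> -1 then active \<phi> \<psi> j else {}). wav_coeff \<phi> \<psi> f j k * w j k x) has_sum s.g x) {-1..}"
      by (rule s.has_sum_g)
    then show ?case using elim by (subst (asm) has_sum_cong) auto
  qed
qed

end

section \<open>Moment generating functions and contamination bias\<close>

lemma nn_integral_exp_half:
  assumes "0 < s"
  shows "(\<integral>\<^sup>+x. ennreal (exp (- s * x) / 2) * indicator {0..} x \<partial>lborel) = ennreal (1 / (2 * s))"
proof -
  have "((\<lambda>x. - exp (- s * x) / (2 * s)) \<longlongrightarrow> - 0 / (2 * s)) at_top"
    using assms
    by (intro tendsto_intros filterlim_compose[OF exp_at_bot]
        filterlim_tendsto_neg_mult_at_bot[OF tendsto_const] filterlim_ident) auto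
  then have "(\<integral>\<^sup>+x. ennreal (exp (- s * x) / 2) * indicator {0..} x \<partial>lborel) =
      ennreal (- 0 / (2 * s) - (- exp (- s * 0) / (2 * s)))"
    using assms by (intro nn_integral_FTC_atLeast) (auto intro!: derivative_eq_intros)
  then show ?thesis by simp
qed

lemma sets_std_laplace [simp]: "sets std_laplace = sets borel"
  by (simp add: std_laplace_def)

text \<open>The moment generating function is \<open>1 / (1 - t^2)\<close>, which is compared with
  an exponential through \<open>(1 - y) * (1 + 2 * y) \<ge> 1\<close> for
  \<open>0 \<le> y \<le> 1 / 2\<close>, at \<open>y = t^2\<close>.\<close>

lemma std_laplace_mgf_le:
  assumes "\<bar>t\<bar> \<le> 1 / 2"
  shows "(\<integral>\<^sup>+x. ennreal (exp (t * x)) \<partial>std_laplace) \<le> ennreal (exp (2 * t\<^sup>2))"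
proof -
  let ?f = "\<lambda>s x. ennreal (exp (- s * x) / 2) * indicator {0..} x"
  have "(\<integral>\<^sup>+x. ennreal (exp (t * x)) \<partial>std_laplace) =
      (\<integral>\<^sup>+x. ennreal (exp (- \<bar>x\<bar>) / 2) * ennreal (exp (t * x)) \<partial>lborel)"
    unfolding std_laplace_def by (subst nn_integral_density) auto
  \<comment> \<open>One exponential per half-line; both count at 0, hence an inequality. The form
    \<open>0 + (-1) * x\<close> prepares the affine substitution that reflects the left
    half.\<close>
  also have "\<dots> \<le> (\<integral>\<^sup>+x. ?f (1 - t) x + ?f (1 + t) (0 + (-1) * x) \<partial>lborel)"
  proof (intro nn_integral_mono)
    fix x :: real
    show "ennreal (exp (- \<bar>x\<bar>) / 2) * ennreal (exp (t * x)) \<le> ?f (1 - t) x + ?f (1 + t) (0 + (-1) * x)"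
    proof (cases "x \<ge> 0")
      case True
      then have "exp (- \<bar>x\<bar>) / 2 * exp (t * x) = exp (- (1 - t) * x) / 2"
        by (simp flip: exp_add) (simp add: algebra_simps)
      then show ?thesis using True
        by (simp add: add_increasing2 flip: ennreal_mult)
    next
      case False
      then have "exp (- \<bar>x\<bar>) / 2 * exp (t * x) = exp (- (1 + t) * (0 + (-1) * x)) / 2"
        by (simp flip: exp_add) (simp add: algebra_simps)
      then show ?thesis using False
        by (simp add: add_increasing flip: ennreal_mult)
    qed
  qed
  also have "\<dots> = (\<integral>\<^sup>+x. ?f (1 - t) x \<partial>lborel) + (\<integral>\<^sup>+x. ?f (1 + t) (0 + (-1) * x) \<partial>lborel)"
    by (intro nn_integral_add) auto
  also have "(\<integral>\<^sup>+x. ?f (1 + t) (0 + (-1) * x) \<partial>lborel) = (\<integral>\<^sup>+x. ?f (1 + t) x \<partial>lborel)"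
    using nn_integral_real_affine[of "?f (1 + t)" "-1" 0] by simp
  also have "(\<integral>\<^sup>+x. ?f (1 - t) x \<partial>lborel) + \<dots> = ennreal (1 / (2 * (1 - t))) + ennreal (1 / (2 * (1 + t)))"
    using assms by (subst (1 2) nn_integral_exp_half) auto
  also have "\<dots> = ennreal (1 / (2 * (1 - t)) + 1 / (2 * (1 + t)))"
    using assms by (intro ennreal_plus[symmetric]) auto
  also have "\<dots> \<le> ennreal (exp (2 * t\<^sup>2))"
  proof (rule ennreal_leI)
    have t2: "t\<^sup>2 \<le> 1 / 2"
      using power_mono[OF assms, of 2] by (simp add: power2_eq_square)
    have "1 \<le> 1 + t\<^sup>2 * (1 - 2 * t\<^sup>2)" using t2 by simp
    also have "\<dots> = (1 - t\<^sup>2) * (1 + 2 * t\<^sup>2)" by (simp add: algebra_simps)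
    also have "\<dots> \<le> (1 - t\<^sup>2) * exp (2 * t\<^sup>2)" using t2 by (intro mult_left_mono exp_ge_add_one_self) auto
    finally have "1 / (1 - t\<^sup>2) \<le> exp (2 * t\<^sup>2)" using t2 by (simp add: field_simps)
    moreover have "1 / (2 * (1 - t)) + 1 / (2 * (1 + t)) = 1 / (1 - t\<^sup>2)"
    proof -
      have "1 - t \<noteq> 0" "1 + t \<noteq> 0" "1 - t\<^sup>2 = (1 - t) * (1 + t)"
        using assms by (auto simp: power2_eq_square algebra_simps)
      then show ?thesis by (simp add: add_divide_eq_iff divide_add_eq_iff eq_divide_eq divide_eq_eq algebra_simps)
    qed
    ultimately show "1 / (2 * (1 - t)) + 1 / (2 * (1 + t)) \<le> exp (2 * t\<^sup>2)" by simp
  qed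
  finally show ?thesis .
qed

text \<open>Hoeffding's lemma on \<open>[-b, b]\<close>. It covers positive \<open>l\<close>; a
  negative \<open>l\<close> is handled by applying it to \<open>- Y\<close>.\<close>

lemma (in prob_space) bounded_mgf_le:
  assumes Y: "random_variable borel Y" "\<And>\<omega>. \<bar>Y \<omega>\<bar> \<le> b"
  shows "(\<integral>\<^sup>+\<omega>. ennreal (exp (l * (Y \<omega> - expectation Y))) \<partial>M) \<le> ennreal (exp (l\<^sup>2 * b\<^sup>2 / 2))"
proof -
  have b: "b \<ge> 0" using Y(2) abs_ge_zero order_trans by blast
  interpret p: interval_bounded_random_variable M Y "-b" b
    using Y by unfold_locales (auto simp: abs_le_iff minus_le_iff)
  interpret n: interval_bounded_random_variable M "\<lambda>x. - Y x" "-b" b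
    using Y by unfold_locales (auto simp: abs_le_iff minus_le_iff)
  have sq: "r\<^sup>2 * (b - - b)\<^sup>2 / 8 = r\<^sup>2 * b\<^sup>2 / 2" for r by (simp add: power2_eq_square)
  consider "l > 0" | "l = 0" | "l < 0" by linarith
  then show ?thesis
  proof cases
    case 1
    then show ?thesis using p.Hoeffdings_lemma_nn_integral[OF 1] by (simp only: sq)
  next
    case 2
    then show ?thesis by (simp add: emeasure_space_1)
  next
    case 3
    then show ?thesis
      using n.Hoeffdings_lemma_nn_integral[of "-l"] unfolding sq by (simp add: algebra_simps)
  qed
qed

section \<open>Integrals under the contaminated distribution\<close>

lemma nn_integral_contaminated:
  assumes sets: "sets P = sets borel" "sets G = sets borel" and u: "u \<in> borel_measurable borel"
  shows "(\<integral>\<^sup>+x. u x \<partial>contaminated \<epsilon> P G) =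
    ennreal (1 - \<epsilon>) * (\<integral>\<^sup>+x. u x \<partial>P) + ennreal \<epsilon> * (\<integral>\<^sup>+x. u x \<partial>G)"
proof -
  note [measurable_cong] = sets sets_contaminated
  \<comment> \<open>Both sides are additive, homogeneous and continuous along increasing sequences
    in \<open>u\<close>, so the claim reduces to indicators.\<close>
  from u show ?thesis
  proof (induction rule: borel_measurable_induct)
    case (cong f g)
    then show ?case by simp
  next
    case (set B)
    then show ?case by (simp add: emeasure_contaminated sets)
  next
    case (mult u c)
    then show ?case by (simp add: nn_integral_cmult distrib_left mult_ac)
  next
    case (add u v)
    then show ?case by (simp add: nn_integral_add distrib_left add_ac)
  next
    case (seq U)
    have P: "(\<integral>\<^sup>+x. (SUP i. U i) x \<partial>Q) = (SUP i. \<integral>\<^sup>+x. U i x \<partial>Q)" if "sets Q = sets borel" for Q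
    proof -
      have "(\<integral>\<^sup>+x. (SUP i. U i) x \<partial>Q) = (\<integral>\<^sup>+x. (SUP i. U i x) \<partial>Q)"
        by (rule nn_integral_cong) (simp only: SUP_apply)
      also have "\<dots> = (SUP i. \<integral>\<^sup>+x. U i x \<partial>Q)"
        using seq by (intro nn_integral_monotone_convergence_SUP) (simp_all add: measurable_cong_sets[OF that refl])
      finally show ?thesis .
    qed
    have mono: "incseq (\<lambda>i. \<integral>\<^sup>+x. U i x \<partial>Q)" for Q
      using seq by (auto simp: incseq_def le_fun_def intro!: nn_integral_mono)
    have "(\<integral>\<^sup>+x. (SUP i. U i) x \<partial>contaminated \<epsilon> P G) =
        (SUP i. ennreal (1 - \<epsilon>) * (\<integral>\<^sup>+x. U i x \<partial>P) + ennreal \<epsilon> * (\<integral>\<^sup>+x. U i x \<partial>G))"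
      by (subst P) (simp_all only: sets_contaminated seq)
    also have "\<dots> = (SUP i. ennreal (1 - \<epsilon>) * (\<integral>\<^sup>+x. U i x \<partial>P)) + (SUP i. ennreal \<epsilon> * (\<integral>\<^sup>+x. U i x \<partial>G))"
      using mono by (intro ennreal_SUP_add) (auto simp: incseq_def intro!: mult_left_mono)
    also have "\<dots> = ennreal (1 - \<epsilon>) * (\<integral>\<^sup>+x. (SUP i. U i) x \<partial>P) + ennreal \<epsilon> * (\<integral>\<^sup>+x. (SUP i. U i) x \<partial>G)"
      unfolding P[OF sets(1)] P[OF sets(2)] by (simp only: SUP_mult_left_ennreal)
    finally show ?case .
  qed
qed

text \<open>Adding \<open>b\<close> makes the integrand non-negative, so the mixture formula for
  non-negative integrals applies; the shift cancels because all three measures have mass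
  one.\<close>

lemma integral_contaminated:
  fixes u :: "real \<Rightarrow> real" and \<epsilon> b :: real
  assumes P: "prob_space P" "sets P = sets borel" and G: "prob_space G" "sets G = sets borel"
    and \<epsilon>: "\<epsilon> \<in> {0..1}" and u: "u \<in> borel_measurable borel" "\<And>x. \<bar>u x\<bar> \<le> b"
  shows "(\<integral>x. u x \<partial>contaminated \<epsilon> P G) = (1 - \<epsilon>) * (\<integral>x. u x \<partial>P) + \<epsilon> * (\<integral>x. u x \<partial>G)"
proof -
  interpret P: prob_space P by fact
  interpret G: prob_space G by fact
  let ?C = "contaminated \<epsilon> P G"
  have "emeasure ?C (space ?C) = ennreal (1 - \<epsilon>) + ennreal \<epsilon>"
    using P.emeasure_space_1 G.emeasure_space_1 sets_eq_imp_space_eq[OF P(2)] sets_eq_imp_space_eq[OF G(2)]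
      sets_eq_imp_space_eq[OF sets_contaminated[of \<epsilon> P G]]
    by (simp add: emeasure_contaminated P G)
  also have "\<dots> = 1" using \<epsilon> by (simp flip: ennreal_plus)
  finally have C: "prob_space ?C" by (rule prob_spaceI)
  have eq: "ennreal (integral\<^sup>L Q u + b) = (\<integral>\<^sup>+x. ennreal (u x + b) \<partial>Q)" and nn: "0 \<le> integral\<^sup>L Q u + b"
    if Q: "prob_space Q" "sets Q = sets borel" for Q
  proof -
    interpret Q: prob_space Q by fact
    note [measurable_cong] = Q(2)
    have int: "integrable Q u" using u by (intro Q.integrable_const_bound[where B = b]) auto
    have nonneg: "0 \<le> u x + b" for x using u(2)[of x] by simp
    have eq: "integral\<^sup>L Q u + b = (\<integral>x. u x + b \<partial>Q)" using int by (simp add: Q.prob_space)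
    show "ennreal (integral\<^sup>L Q u + b) = (\<integral>\<^sup>+x. ennreal (u x + b) \<partial>Q)" "0 \<le> integral\<^sup>L Q u + b"
      unfolding eq using int nonneg
      by (simp_all add: nn_integral_eq_integral del: Bochner_Integration.integral_add)
  qed
  have "ennreal (integral\<^sup>L ?C u + b) =
      ennreal (1 - \<epsilon>) * ennreal (integral\<^sup>L P u + b) + ennreal \<epsilon> * ennreal (integral\<^sup>L G u + b)"
    using u by (simp add: eq P G C nn_integral_contaminated)
  also have "\<dots> = ennreal ((1 - \<epsilon>) * (integral\<^sup>L P u + b) + \<epsilon> * (integral\<^sup>L G u + b))"
    using \<epsilon> nn[OF P] nn[OF G] by (simp flip: ennreal_plus ennreal_mult)
  finally have "integral\<^sup>L ?C u + b = (1 - \<epsilon>) * (integral\<^sup>L P u + b) + \<epsilon> * (integral\<^sup>L G u + b)"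
    using \<epsilon> nn[OF P] nn[OF G] nn[OF C] by (subst (asm) ennreal_inj) auto
  then show ?thesis by (simp add: algebra_simps)
qed

text \<open>The means differ by \<open>\<epsilon>\<close> times the difference of the means under
  \<open>G\<close> and \<open>P\<close>, and each of these is bounded by \<open>b\<close>.\<close>

lemma contaminated_bias_le:
  fixes u :: "real \<Rightarrow> real" and \<epsilon> b :: real
  assumes P: "prob_space P" "sets P = sets borel" and G: "prob_space G" "sets G = sets borel"
    and \<epsilon>: "\<epsilon> \<in> {0..1}" and u: "u \<in> borel_measurable borel" "\<And>x. \<bar>u x\<bar> \<le> b"
  shows "\<bar>(\<integral>x. u x \<partial>contaminated \<epsilon> P G) - (\<integral>x. u x \<partial>P)\<bar> \<le> 2 * \<epsilon> * b"
proof -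
  have bound: "\<bar>integral\<^sup>L Q u\<bar> \<le> b" if Q: "prob_space Q" "sets Q = sets borel" for Q
  proof -
    interpret Q: prob_space Q by fact
    note [measurable_cong] = Q(2)
    have "integrable Q u" using u by (intro Q.integrable_const_bound[where B = b]) auto
    then have "\<bar>integral\<^sup>L Q u\<bar> \<le> (\<integral>x. b \<partial>Q)"
      using u by (intro order_trans[OF integral_abs_bound] integral_mono) auto
    then show ?thesis by (simp add: Q.prob_space)
  qed
  have "(\<integral>x. u x \<partial>contaminated \<epsilon> P G) - (\<integral>x. u x \<partial>P) = \<epsilon> * (integral\<^sup>L G u - integral\<^sup>L P u)"
    using integral_contaminated[OF assms] by (simp add: algebra_simps)
  moreover have "\<bar>integral\<^sup>L G u - integral\<^sup>L P u\<bar> \<le> 2 * b" using bound[OF P] bound[OF G] by linarith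
  ultimately show ?thesis
    using \<epsilon> mult_left_mono[of "\<bar>integral\<^sup>L G u - integral\<^sup>L P u\<bar>" "2 * b" \<epsilon>]
    by (simp add: abs_mult mult_ac)
qed

section \<open>Moment generating function of a centred coefficient estimate\<close>

context compact_wavelet
begin

text \<open>The centred estimate is an average of \<open>n\<close> data terms and \<open>n\<close>
  noise terms, all independent, so its moment generating function factorises. The number
  \<open>\<tau>\<close> bounds both the wavelet and the noise scale, and
  \<open>\<bar>l\<bar> * \<tau> \<le> n / 2\<close> keeps the Laplace factors within the range of
  \<open>std_laplace_mgf_le\<close>.\<close>

lemma coeff_estimate_mgf_le:
  fixes n J :: nat and P :: "real measure" and \<alpha> \<tau> l :: real
  assumes priv: "private_sample \<phi> \<psi> n J P M X W" and n: "n \<ge> 1"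
    and jk: "j \<in> {-1..int J}" "k \<in> active \<phi> \<psi> j"
    and \<tau>: "wbound * 2 powr (j / 2) \<le> \<tau>" "\<bar>noise_scale A \<psi> \<alpha> J\<bar> \<le> \<tau>" and l: "\<bar>l\<bar> * \<tau> \<le> n / 2"
  shows "(\<integral>\<^sup>+\<omega>. ennreal (exp (l * (coeff_estimate A \<phi> \<psi> \<alpha> J n X W j k \<omega> - (\<integral>x. w j k x \<partial>P)))) \<partial>M)
    \<le> ennreal (exp (3 * l\<^sup>2 * \<tau>\<^sup>2 / n))"
proof -
  interpret prob_space M using priv by (simp add: private_sample_def)
  define \<mu> where "\<mu> = (\<integral>x. w j k x \<partial>P)"
  define \<sigma> where "\<sigma> = noise_scale A \<psi> \<alpha> J"
  define t where "t = l / n"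
  let ?T = "(\<lambda>i. (i, j, k)) ` {1..n}"
  \<comment> \<open>The exponential factor of each independent variable: \<open>Inl\<close> for an
    observation, \<open>Inr\<close> for the noise added to it at the coefficient
    \<open>(j, k)\<close>.\<close>
  define h where "h s x = (case s of Inl i \<Rightarrow> ennreal (exp (t * (w j k x - \<mu>)))
    | Inr r \<Rightarrow> ennreal (exp (t * \<sigma> * x)))" for s :: "nat + nat \<times> int \<times> int" and x
  have T: "?T \<subseteq> noise_index \<phi> \<psi> n J" using jk by (auto simp: noise_index_def)
  have "indep_vars (\<lambda>_. borel) (case_sum X W) ({1..n} <+> noise_index \<phi> \<psi> n J)"
    using priv by (simp add: private_sample_def)
  then have ind: "indep_vars (\<lambda>_. borel) (case_sum X W) ({1..n} <+> ?T)"
    by (rule indep_vars_subset) (use T in auto)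
  have ind': "indep_vars (\<lambda>_. borel) (\<lambda>s \<omega>. h s (case_sum X W s \<omega>)) ({1..n} <+> ?T)"
    by (rule indep_vars_compose2[OF ind]) (auto simp: h_def)
  have rvX: "random_variable borel (X i)" if "i \<in> {1..n}" for i
    using ind that by (auto simp: indep_vars_def dest: bspec[where x = "Inl i"])
  have rvW: "random_variable borel (W s)" if "s \<in> ?T" for s
    using ind that by (auto simp: indep_vars_def dest: bspec[where x = "Inr s"])
  have exp_eq: "ennreal (exp (l * (coeff_estimate A \<phi> \<psi> \<alpha> J n X W j k \<omega> - \<mu>))) =
      (\<Prod>s\<in>{1..n} <+> ?T. h s (case_sum X W s \<omega>))" for \<omega>
  proof -
    have "l * (coeff_estimate A \<phi> \<psi> \<alpha> J n X W j k \<omega> - \<mu>) =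
        (\<Sum>i=1..n. t * (w j k (X i \<omega>) - \<mu>)) + (\<Sum>i=1..n. t * \<sigma> * W (i, j, k) \<omega>)"
      using n by (simp add: coeff_estimate_def privatised_def t_def \<sigma>_def sum.distrib sum_subtractf
          sum_distrib_left[symmetric] sum_divide_distrib[symmetric] field_simps)
    also have "(\<Sum>i=1..n. t * \<sigma> * W (i, j, k) \<omega>) = (\<Sum>s\<in>?T. t * \<sigma> * W s \<omega>)"
      by (subst sum.reindex) (auto simp: inj_on_def)
    finally show ?thesis
      by (simp add: exp_add exp_sum prod.Plus h_def prod_ennreal ennreal_mult prod_nonneg)
  qed
  have \<tau>0: "0 \<le> \<tau>" using \<tau>(2) by linarith
  have "(\<integral>\<^sup>+\<omega>. h s (case_sum X W s \<omega>) \<partial>M) \<le> ennreal (exp (case s of Inl i \<Rightarrow> t\<^sup>2 * \<tau>\<^sup>2 / 2 | Inr r \<Rightarrow> 2 * t\<^sup>2 * \<tau>\<^sup>2))"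
    if s: "s \<in> {1..n} <+> ?T" for s
  proof (cases s)
    case (Inl i)
    with s have i: "i \<in> {1..n}" by auto
    have "distr M borel (X i) = P" using priv i by (simp add: private_sample_def)
    then have "\<mu> = expectation (\<lambda>\<omega>. w j k (X i \<omega>))"
      using integral_distr[OF rvX[OF i], of "w j k"] by (simp add: \<mu>_def)
    moreover have "\<bar>w j k (X i \<omega>)\<bar> \<le> \<tau>" for \<omega> using wav_le[of j k "X i \<omega>"] \<tau>(1) jk(1) by simp
    ultimately show ?thesis
      using bounded_mgf_le[of "\<lambda>\<omega>. w j k (X i \<omega>)" \<tau> t] rvX[OF i] Inl by (simp add: h_def)
  next
    case (Inr r)
    with s have r: "r \<in> ?T" by auto
    have "distr M borel (W r) = std_laplace" using priv r T by (auto simp: private_sample_def)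
    then have "(\<integral>\<^sup>+\<omega>. ennreal (exp (t * \<sigma> * W r \<omega>)) \<partial>M) = (\<integral>\<^sup>+x. ennreal (exp (t * \<sigma> * x)) \<partial>std_laplace)"
      using nn_integral_distr[OF rvW[OF r], of "\<lambda>x. ennreal (exp (t * \<sigma> * x))"]
      by (simp add: measurable_cong_sets[OF sets_std_laplace refl])
    also have "\<dots> \<le> ennreal (exp (2 * (t * \<sigma>)\<^sup>2))"
    proof (rule std_laplace_mgf_le)
      have "\<bar>t * \<sigma>\<bar> \<le> \<bar>t\<bar> * \<tau>" using \<tau> by (auto simp: abs_mult \<sigma>_def intro!: mult_left_mono)
      also have "\<dots> \<le> 1 / 2" using l n by (simp add: t_def field_simps)
      finally show "\<bar>t * \<sigma>\<bar> \<le> 1 / 2" .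
    qed
    also have "\<dots> \<le> ennreal (exp (2 * t\<^sup>2 * \<tau>\<^sup>2))"
      using power_mono[OF \<tau>(2), of 2] by (auto simp: power_mult_distrib \<sigma>_def intro!: ennreal_leI mult_left_mono)
    finally show ?thesis using Inr by (simp add: h_def)
  qed
  then have "(\<Prod>s\<in>{1..n} <+> ?T. \<integral>\<^sup>+\<omega>. h s (case_sum X W s \<omega>) \<partial>M) \<le>
      (\<Prod>s\<in>{1..n} <+> ?T. ennreal (exp (case s of Inl i \<Rightarrow> t\<^sup>2 * \<tau>\<^sup>2 / 2 | Inr r \<Rightarrow> 2 * t\<^sup>2 * \<tau>\<^sup>2)))"
    by (intro prod_mono_ennreal)
  also have "\<dots> = ennreal (exp (\<Sum>s\<in>{1..n} <+> ?T. case s of Inl i \<Rightarrow> t\<^sup>2 * \<tau>\<^sup>2 / 2 | Inr r \<Rightarrow> 2 * t\<^sup>2 * \<tau>\<^sup>2))"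
    by (simp add: prod_ennreal exp_sum)
  also have "(\<Sum>s\<in>{1..n} <+> ?T. case s of Inl i \<Rightarrow> t\<^sup>2 * \<tau>\<^sup>2 / 2 | Inr r \<Rightarrow> 2 * t\<^sup>2 * \<tau>\<^sup>2) =
      n * (t\<^sup>2 * \<tau>\<^sup>2 / 2) + n * (2 * t\<^sup>2 * \<tau>\<^sup>2)"
    by (simp add: sum.Plus card_image inj_on_def)
  \<comment> \<open>With \<open>t = l / n\<close>, each observation contributes \<open>1 / 2\<close>
    from Hoeffding and \<open>2\<close> from Laplace; the total \<open>5 / 2\<close> is then rounded
    up to 3.\<close>
  also have "\<dots> = 5 / 2 * (l\<^sup>2 * \<tau>\<^sup>2 / n)"
    using n by (simp add: t_def power2_eq_square field_simps)
  also have "ennreal (exp \<dots>) \<le> ennreal (exp (3 * l\<^sup>2 * \<tau>\<^sup>2 / n))"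
    using mult_right_mono[of "5 / 2" 3 "l\<^sup>2 * \<tau>\<^sup>2 / n"] by (intro ennreal_leI) (simp add: mult.assoc)
  finally have "(\<Prod>s\<in>{1..n} <+> ?T. \<integral>\<^sup>+\<omega>. h s (case_sum X W s \<omega>) \<partial>M) \<le> ennreal (exp (3 * l\<^sup>2 * \<tau>\<^sup>2 / n))" .
  then show ?thesis
    unfolding \<mu>_def[symmetric] exp_eq
    using indep_vars_nn_integral[OF _ ind'] by simp
qed

end

section \<open>Risk bound\<close>

lemma sup_norm_le: "(\<And>x. x \<in> {0..1} \<Longrightarrow> \<bar>g x\<bar> \<le> c) \<Longrightarrow> sup_norm g \<le> ennreal c"
  unfolding sup_norm_def by (intro SUP_least ennreal_leI)

lemma ess_sup_norm_le:
  assumes "g \<in> borel_measurable borel" "AE x in lborel. \<bar>g x\<bar> \<le> c"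
  shows "ess_sup_norm g \<le> ennreal c"
  unfolding ess_sup_norm_def
proof (rule esssup_I)
  show "(\<lambda>x. ennreal \<bar>g x\<bar>) \<in> borel_measurable (restrict_space lborel {0..1})"
    using assms(1) by (intro measurable_restrict_space1) measurable
  show "AE x in restrict_space lborel {0..1}. ennreal \<bar>g x\<bar> \<le> ennreal c"
    using assms(2) by (subst AE_restrict_space_iff) (auto intro: ennreal_leI)
qed

text \<open>A union bound in disguise: no expectation of a maximum is ever needed.\<close>

lemma abs_le_exp_sum:
  fixes D :: "'i \<Rightarrow> real"
  assumes "finite T" "t \<in> T" "0 < l"
  shows "\<bar>D t\<bar> \<le> (L + exp (- L) * (\<Sum>s\<in>T. exp (l * D s) + exp (- l * D s))) / l"
proof -
  \<comment> \<open>The shift \<open>L\<close> adds \<open>L / l\<close> to the bound and in return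
    damps the sum of exponentials by \<open>exp (- L)\<close>.\<close>
  have "l * \<bar>D t\<bar> - L \<le> exp (l * \<bar>D t\<bar> - L)"
    using exp_ge_add_one_self[of "l * \<bar>D t\<bar> - L"] by linarith
  also have "\<dots> = exp (- L) * exp (l * \<bar>D t\<bar>)" by (simp flip: exp_add)
  also have "exp (l * \<bar>D t\<bar>) \<le> exp (l * D t) + exp (- l * D t)"
    by (cases "D t \<ge> 0") (auto simp: add_increasing add_increasing2)
  also have "\<dots> \<le> (\<Sum>s\<in>T. exp (l * D s) + exp (- l * D s))"
    using assms by (intro member_le_sum[of t T "\<lambda>s. exp (l * D s) + exp (- l * D s)"]) (auto simp: add_nonneg_nonneg)
  finally show ?thesis using assms by (simp add: field_simps)
qed

section \<open>Counting, truncation error and the risk for free parameters \<open>l\<close> and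
  \<open>L\<close>\<close>

context compact_wavelet
begin

lemma sum_powr_half_le: "(\<Sum>j\<in>{-1..int J}. 2 powr (real_of_int j / 2)) \<le> 4 * 2 powr (real J / 2)"
  unfolding sum_levels
proof (induction J)
  case 0
  have "2 powr (- 1 / 2) \<le> (2::real) powr 0" by (intro powr_mono) auto
  then show ?case by (simp add: eval_nat_numeral)
next
  case (Suc J)
  have e: "2 powr (real (Suc J) / 2) = sqrt 2 * 2 powr (real J / 2)"
    by (simp add: add_divide_distrib powr_add powr_half_sqrt)
  \<comment> \<open>The induction step needs \<open>4 + sqrt 2 \<le> 4 * sqrt 2\<close>, which is
    this inequality.\<close>
  have "4 / 3 \<le> sqrt 2" by (rule real_le_rsqrt) (simp add: power2_eq_square)
  then have "4 / 3 * 2 powr (real J / 2) \<le> sqrt 2 * 2 powr (real J / 2)" by (intro mult_right_mono) auto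
  then have "4 * 2 powr (real J / 2) + 2 powr (real (Suc J) / 2) \<le> 4 * (2::real) powr (real (Suc J) / 2)"
    unfolding e by linarith
  moreover have "(\<Sum>l<Suc J + 2. 2 powr (real_of_int (int l - 1) / 2)) =
      (\<Sum>l<J + 2. 2 powr (real_of_int (int l - 1) / 2)) + (2::real) powr (real (Suc J) / 2)"
    by simp
  ultimately show ?case using Suc by linarith
qed

text \<open>The dilations \<open>1 + 1 + 2 + ... + 2 ^ J\<close> add up to \<open>2 * 2 ^ J\<close>,
  and the constant \<open>2 * A + 1\<close> from each of the \<open>J + 2\<close> levels is absorbed
  by \<open>J + 2 \<le> 2 * 2 ^ J\<close>.\<close>

lemma card_active_le:
  "card (SIGMA j:{-1..int J}. active \<phi> \<psi> j) \<le> (4 * A + 6) * 2 ^ J"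
proof -
  have "card (active \<phi> \<psi> j) \<le> 2 * scale j + 2 * A + 1" if "j \<ge> -1" for j
  proof -
    have "window 1 j = {k. - (scale j + A) \<le> of_int k \<and> of_int k \<le> scale j + A}"
      by (auto simp: window_def abs_le_iff)
    then have "card (window 1 j) \<le> 2 * scale j + 2 * A + 1"
      using card_int_interval_le(2)[of "- (scale j + A)" "scale j + A"] scale_ge_1[OF that] A_pos by simp
    moreover have "card (active \<phi> \<psi> j) \<le> card (window 1 j)"
      using active_subset[OF that] by (intro card_mono) auto
    ultimately show ?thesis by linarith
  qed
  then have "real (card (SIGMA j:{-1..int J}. active \<phi> \<psi> j)) \<le>
      (\<Sum>j\<in>{-1..int J}. 2 * scale j + 2 * A + 1)"
    unfolding card_SigmaI[OF finite_atLeastAtMost_int ballI[OF finite_active_level]] of_nat_sum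
    by (intro sum_mono) auto
  also have "\<dots> = 4 * 2 ^ J + (real J + 2) * (2 * A + 1)"
    unfolding sum_levels
  proof (induction J)
    case 0
    show ?case by (simp add: eval_nat_numeral scale_def algebra_simps)
  next
    case (Suc J)
    have "scale (int (J + 2) - 1) = 2 * 2 ^ J"
      by (simp add: scale_def powr_add powr_realpow)
    then show ?case using Suc by (simp add: algebra_simps)
  qed
  finally have "real (card (SIGMA j:{-1..int J}. active \<phi> \<psi> j)) \<le> 4 * 2 ^ J + (real J + 2) * (2 * A + 1)" .
  moreover have "real J + 2 \<le> 2 * 2 ^ J"
    by (induction J) auto
  then have "(real J + 2) * (2 * A + 1) \<le> 2 * 2 ^ J * (2 * A + 1)"
    using A_pos by (intro mult_right_mono) auto
  moreover have "4 * 2 ^ J + 2 * 2 ^ J * (2 * A + 1) = (4 * A + 6) * 2 ^ J"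
    by (simp add: algebra_simps)
  ultimately show ?thesis by linarith
qed

text \<open>This is \<open>gconst * q / (1 - q)\<close> of \<open>wavelet_series\<close> for the
  coefficients of a density, with \<open>\<gamma> = \<beta>\<close> and
  \<open>c = sqrt (max R 0)\<close>.\<close>

definition tail_const :: "real \<Rightarrow> real \<Rightarrow> real" where
  "tail_const \<beta> R = sqrt (max R 0) * (2 * A + 1) * wbound / (1 - 2 powr (1 / 2 - \<beta>))"

lemma tail_const_nonneg: "\<beta> > 1 / 2 \<Longrightarrow> 0 \<le> tail_const \<beta> R"
  using A_pos wbound_nonneg by (auto simp: tail_const_def intro!: mult_nonneg_nonneg divide_nonneg_nonneg less_imp_le[OF powr_less_one])

lemma sobolev_tail_le:
  assumes R: "sobolev_sum \<phi> \<psi> \<beta> f \<le> ennreal R" and \<beta>: "\<beta> > 1 / 2"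
    and sum: "((\<lambda>j. \<Sum>k\<in>active \<phi> \<psi> j. wav_coeff \<phi> \<psi> f j k * w j k x) has_sum f x) {-1..}"
  shows "\<bar>f x - (\<Sum>j\<in>{-1..int J}. \<Sum>k\<in>active \<phi> \<psi> j. wav_coeff \<phi> \<psi> f j k * w j k x)\<bar>
    \<le> tail_const \<beta> R * 2 powr (- (\<beta> - 1 / 2) * J)"
proof -
  let ?F = "\<lambda>j. if j \<ge> -1 then active \<phi> \<psi> j else {}"
  interpret s: wavelet_series A \<phi> \<psi> "wav_coeff \<phi> \<psi> f" ?F "sqrt (max R 0)" \<beta> 1
    using \<beta> active_subset sobolev_coeff_le[OF R] by unfold_locales auto
  have "((\<lambda>j. \<Sum>k\<in>?F j. wav_coeff \<phi> \<psi> f j k * w j k x) has_sum f x) {-1..}"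
    using sum by (subst has_sum_cong) auto
  from s.tail_le[OF this, of J]
  have "\<bar>f x - (\<Sum>j\<in>{-1..int J}. \<Sum>k\<in>active \<phi> \<psi> j. wav_coeff \<phi> \<psi> f j k * w j k x)\<bar>
      \<le> s.gconst / (1 - s.q) * s.q ^ (J + 2)" by simp
  also have "\<dots> = tail_const \<beta> R * (s.q * s.q ^ J)"
    using s.q by (simp add: s.gconst_def tail_const_def s.q_def[symmetric])
  also have "\<dots> \<le> tail_const \<beta> R * s.q ^ J"
    using s.q tail_const_nonneg[OF \<beta>, of R] by (intro mult_left_mono) (auto simp: mult_left_le_one_le)
  also have "s.q ^ J = 2 powr (- (\<beta> - 1 / 2) * J)"
    by (simp add: s.q_def powr_powr flip: powr_realpow)
  finally show ?thesis .
qed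

text \<open>A deterministic statement at one point: \<open>b\<close> is any array of coefficients,
  so randomness will enter only through \<open>b\<close> and the error bound \<open>E\<close>. The
  costs \<open>2 powr (j / 2)\<close> of the levels sum geometrically to the order of the last
  one.\<close>

lemma estimation_error_le:
  assumes R: "sobolev_sum \<phi> \<psi> \<beta> f \<le> ennreal R" and \<beta>: "\<beta> > 1 / 2"
    and sum: "((\<lambda>j. \<Sum>k\<in>active \<phi> \<psi> j. wav_coeff \<phi> \<psi> f j k * w j k x) has_sum f x) {-1..}"
    and b: "\<And>j k. j \<in> {-1..int J} \<Longrightarrow> k \<in> active \<phi> \<psi> j \<Longrightarrow> \<bar>b j k - wav_coeff \<phi> \<psi> f j k\<bar> \<le> E"
    and E: "0 \<le> E"
  shows "\<bar>(\<Sum>j\<in>{-1..int J}. \<Sum>k\<in>active \<phi> \<psi> j. b j k * w j k x) - f x\<bar>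
    \<le> 4 * (2 * A + 1) * wbound * 2 powr (J / 2) * E + tail_const \<beta> R * 2 powr (- (\<beta> - 1 / 2) * J)"
proof -
  let ?S = "\<lambda>b. \<Sum>j\<in>{-1..int J}. \<Sum>k\<in>active \<phi> \<psi> j. b j k * w j k x"
  have "\<bar>?S b - ?S (wav_coeff \<phi> \<psi> f)\<bar> =
      \<bar>\<Sum>j\<in>{-1..int J}. \<Sum>k\<in>active \<phi> \<psi> j. (b j k - wav_coeff \<phi> \<psi> f j k) * w j k x\<bar>"
    by (simp add: sum_subtractf left_diff_distrib)
  also have "\<dots> \<le> (\<Sum>j\<in>{-1..int J}. E * ((2 * A + 1) * wbound * 2 powr (j / 2)))"
    using b E by (intro order_trans[OF sum_abs] sum_mono level_le) auto
  also have "\<dots> = E * (2 * A + 1) * wbound * (\<Sum>j\<in>{-1..int J}. 2 powr (real_of_int j / 2))"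
    by (simp add: sum_distrib_left mult_ac)
  also have "\<dots> \<le> E * (2 * A + 1) * wbound * (4 * 2 powr (J / 2))"
    using E A_pos wbound_nonneg by (intro mult_left_mono sum_powr_half_le) auto
  finally have "\<bar>?S b - ?S (wav_coeff \<phi> \<psi> f)\<bar> \<le> 4 * (2 * A + 1) * wbound * 2 powr (J / 2) * E"
    by (simp only: mult_ac)
  then show ?thesis using sobolev_tail_le[OF R \<beta> sum, of J] by linarith
qed

text \<open>The loss \<open>N\<close> is abstract so that the supremum and the essential supremum
  share one argument. The error bound \<open>E\<close> is taken random, contamination bias plus the
  bound of \<open>abs_le_exp_sum\<close>, and its expectation follows from the moment generating
  functions.\<close>

lemma risk_le:
  fixes n J :: nat and \<alpha> \<epsilon> \<tau> l L d :: real
  defines "a \<equiv> 4 * (2 * A + 1) * wbound * 2 powr (real J / 2)"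
  assumes f: "f \<in> sobolev_class \<phi> \<psi> \<beta>"
    and G: "prob_space G" "sets G = sets borel" and \<epsilon>: "\<epsilon> \<in> {0..1}"
    and priv: "private_sample \<phi> \<psi> n J (contaminated \<epsilon> (density lborel f) G) M X W" and n: "n \<ge> 1"
    and \<tau>: "wbound * 2 powr (real J / 2) \<le> \<tau>" "\<bar>noise_scale A \<psi> \<alpha> J\<bar> \<le> \<tau>"
    and l: "0 < l" "l * \<tau> \<le> n / 2" and L: "0 \<le> L" and d: "0 \<le> d"
    and N: "\<And>b E. (\<And>j k. j \<in> {-1..int J} \<Longrightarrow> k \<in> active \<phi> \<psi> j \<Longrightarrow> \<bar>b j k - wav_coeff \<phi> \<psi> f j k\<bar> \<le> E)
      \<Longrightarrow> 0 \<le> E \<Longrightarrow>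
      N (\<lambda>x. (\<Sum>j\<in>{-1..int J}. \<Sum>k\<in>active \<phi> \<psi> j. b j k * w j k x) - f x) \<le> ennreal (a * E + d)"
  shows "risk N M (f_Lap A \<phi> \<psi> \<alpha> J n X W) f \<le>
    ennreal (a * (2 * \<epsilon> * wbound * 2 powr (real J / 2)
      + (L + exp (- L) * (2 * ((4 * A + 6) * 2 ^ J) * exp (3 * l\<^sup>2 * \<tau>\<^sup>2 / n))) / l) + d)"
proof -
  interpret prob_space M using priv by (simp add: private_sample_def)
  let ?P = "density lborel f" and ?C = "contaminated \<epsilon> (density lborel f) G"
  let ?T = "SIGMA j:{-1..int J}. active \<phi> \<psi> j"
  have fm: "f \<in> borel_measurable borel" and f0: "\<And>x. 0 \<le> f x" "\<And>x. x \<notin> {0..1} \<Longrightarrow> f x = 0"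
    and f1: "(\<integral>\<^sup>+x. ennreal (f x) \<partial>lborel) = 1"
    using f by (auto simp: sobolev_class_def)
  have P: "prob_space ?P" "sets ?P = sets borel"
    using fm f1 by (auto intro!: prob_spaceI simp: emeasure_density)
  have coeff: "(\<integral>x. w j k x \<partial>?P) = wav_coeff \<phi> \<psi> f j k" for j k
    using fm f0 unfolding wav_coeff_def by (subst integral_density) auto
  have a: "0 \<le> a" using A_pos wbound_nonneg by (simp add: a_def)
  define D where "D t \<omega> = coeff_estimate A \<phi> \<psi> \<alpha> J n X W (fst t) (snd t) \<omega> - (\<integral>x. w (fst t) (snd t) x \<partial>?C)" for t \<omega>
  have half: "2 powr (real_of_int j / 2) \<le> (2::real) powr (real J / 2)" if "j \<le> int J" for j
    using that by (intro powr_mono) auto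
  define Z where "Z \<omega> = (\<Sum>t\<in>?T. exp (l * D t \<omega>) + exp (- l * D t \<omega>))" for \<omega>
  define e where "e = 2 * \<epsilon> * wbound * 2 powr (real J / 2)"
  have Z0: "0 \<le> Z \<omega>" for \<omega> by (auto simp: Z_def intro!: sum_nonneg)
  have e0: "0 \<le> e" using \<epsilon> wbound_nonneg by (auto simp: e_def)
  have finT: "finite ?T" by simp
  \<comment> \<open>For each outcome the loss is dominated by an affine function of
    \<open>Z\<close>, so only the expectation of \<open>Z\<close> remains to be bounded.\<close>
  have point: "N (\<lambda>x. f_Lap A \<phi> \<psi> \<alpha> J n X W \<omega> x - f x) \<le> ennreal (a * (e + (L + exp (- L) * Z \<omega>) / l) + d)" for \<omega>
    unfolding f_Lap_def
  proof (rule N)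
    show "0 \<le> e + (L + exp (- L) * Z \<omega>) / l" using e0 L l Z0 by simp
    fix j k assume jk: "j \<in> {-1..int J}" "k \<in> active \<phi> \<psi> j"
    have "\<bar>D (j, k) \<omega>\<bar> \<le> (L + exp (- L) * Z \<omega>) / l"
      unfolding Z_def using jk l by (intro abs_le_exp_sum[OF finT]) auto
    moreover have "\<bar>(\<integral>x. w j k x \<partial>?C) - wav_coeff \<phi> \<psi> f j k\<bar> \<le> 2 * \<epsilon> * (wbound * 2 powr (real_of_int j / 2))"
      using contaminated_bias_le[OF P G \<epsilon> wav_measurable wav_le] jk by (simp add: coeff)
    moreover have "2 * \<epsilon> * (wbound * 2 powr (real_of_int j / 2)) \<le> e"
      unfolding e_def mult.assoc using half jk wbound_nonneg \<epsilon> by (intro mult_left_mono) auto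
    ultimately show "\<bar>coeff_estimate A \<phi> \<psi> \<alpha> J n X W j k \<omega> - wav_coeff \<phi> \<psi> f j k\<bar> \<le> e + (L + exp (- L) * Z \<omega>) / l"
      by (simp add: D_def)
  qed
  have rvX: "random_variable borel (X i)" if "i \<in> {1..n}" for i
    using priv that by (auto simp: private_sample_def indep_vars_def dest: bspec[where x = "Inl i"])
  have rvW: "random_variable borel (W s)" if "s \<in> noise_index \<phi> \<psi> n J" for s
    using priv that by (auto simp: private_sample_def indep_vars_def dest: bspec[where x = "Inr s"])
  have Dm: "random_variable borel (D t)" if "t \<in> ?T" for t
  proof -
    have "random_variable borel (\<lambda>\<omega>. wav \<phi> \<psi> (fst t) (snd t) (X i \<omega>))" if "i \<in> {1..n}" for i
      by (rule measurable_compose[OF rvX[OF that] wav_measurable])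
    moreover have "random_variable borel (W (i, fst t, snd t))" if "i \<in> {1..n}" for i
      using that \<open>t \<in> ?T\<close> by (intro rvW) (auto simp: noise_index_def)
    ultimately show ?thesis
      unfolding D_def coeff_estimate_def privatised_def by (intro borel_measurable_diff borel_measurable_times
          borel_measurable_sum borel_measurable_add borel_measurable_const) auto
  qed
  define mg where "mg = exp (3 * l\<^sup>2 * \<tau>\<^sup>2 / n)"
  have mgf: "(\<integral>\<^sup>+\<omega>. ennreal (exp (l' * D t \<omega>)) \<partial>M) \<le> ennreal mg" if t: "t \<in> ?T" and l': "\<bar>l'\<bar> = l" for t l'
  proof -
    have "l'\<^sup>2 = l\<^sup>2" using l' by (metis power2_abs)
    moreover have "wbound * 2 powr (real_of_int (fst t) / 2) \<le> \<tau>"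
      using mult_left_mono[OF half[of "fst t"] wbound_nonneg] t \<tau>(1) by fastforce
    ultimately show ?thesis
      using coeff_estimate_mgf_le[OF priv n, of "fst t" "snd t" \<tau> \<alpha> l'] t \<tau>(2) l l'
      by (auto simp: D_def mg_def)
  qed
  have Zm: "random_variable borel Z" unfolding Z_def using Dm by measurable
  have EZ: "(\<integral>\<^sup>+\<omega>. ennreal (Z \<omega>) \<partial>M) \<le> ennreal (2 * ((4 * A + 6) * 2 ^ J) * mg)"
  proof -
    have "(\<integral>\<^sup>+\<omega>. ennreal (Z \<omega>) \<partial>M) = (\<integral>\<^sup>+\<omega>. (\<Sum>t\<in>?T. ennreal (exp (l * D t \<omega>)) + ennreal (exp (- l * D t \<omega>))) \<partial>M)"
      by (intro nn_integral_cong) (simp add: Z_def sum_ennreal[symmetric] add_nonneg_nonneg)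
    also have "\<dots> = (\<Sum>t\<in>?T. (\<integral>\<^sup>+\<omega>. ennreal (exp (l * D t \<omega>)) \<partial>M) + (\<integral>\<^sup>+\<omega>. ennreal (exp (- l * D t \<omega>)) \<partial>M))"
      using Dm by (subst nn_integral_sum) (auto simp: nn_integral_add intro!: sum.cong)
    also have "\<dots> \<le> (\<Sum>t\<in>?T. ennreal mg + ennreal mg)"
      using l by (intro sum_mono add_mono mgf) auto
    also have "\<dots> = of_nat (card ?T) * ennreal (2 * mg)"
      unfolding sum_constant by (simp add: mg_def flip: ennreal_plus)
    also have "\<dots> = ennreal (real (card ?T) * (2 * mg))"
      by (simp only: ennreal_of_nat_eq_real_of_nat ennreal_mult' of_nat_0_le_iff)
    also have "\<dots> = ennreal (2 * real (card ?T) * mg)"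
      by (simp only: mult_ac)
    also have "\<dots> \<le> ennreal (2 * ((4 * A + 6) * 2 ^ J) * mg)"
      by (intro ennreal_leI mult_right_mono mult_left_mono card_active_le) (auto simp: mg_def)
    finally show ?thesis .
  qed
  \<comment> \<open>The affine form lets the integral act on \<open>Z\<close> alone. It is used once
    at \<open>Z \<omega>\<close> and once backwards at the bound on its expectation.\<close>
  have split: "ennreal (a * (e + (L + exp (- L) * z) / l) + d) =
      ennreal (a * (e + L / l) + d) + ennreal (a * exp (- L) / l) * ennreal z" if "0 \<le> z" for z
  proof -
    have "a * (e + (L + exp (- L) * z) / l) + d = (a * (e + L / l) + d) + a * exp (- L) / l * z"
      using l by (simp add: field_simps)
    moreover have "0 \<le> a * (e + L / l) + d" "0 \<le> a * exp (- L) / l" using a e0 L l d by auto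
    then have "ennreal (a * (e + L / l) + d + a * exp (- L) / l * z) =
        ennreal (a * (e + L / l) + d) + ennreal (a * exp (- L) / l) * ennreal z"
      using that by (simp only: ennreal_plus ennreal_mult mult_nonneg_nonneg)
    ultimately show ?thesis by (simp only:)
  qed
  have "risk N M (f_Lap A \<phi> \<psi> \<alpha> J n X W) f \<le> (\<integral>\<^sup>+\<omega>. ennreal (a * (e + (L + exp (- L) * Z \<omega>) / l) + d) \<partial>M)"
    unfolding risk_def by (intro nn_integral_mono point)
  also have "\<dots> = ennreal (a * (e + L / l) + d) + ennreal (a * exp (- L) / l) * (\<integral>\<^sup>+\<omega>. ennreal (Z \<omega>) \<partial>M)"
    using Zm by (simp add: split[OF Z0] nn_integral_add nn_integral_cmult emeasure_space_1)
  also have "\<dots> \<le> ennreal (a * (e + L / l) + d) + ennreal (a * exp (- L) / l) * ennreal (2 * ((4 * A + 6) * 2 ^ J) * mg)"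
    by (intro add_left_mono mult_left_mono EZ) auto
  also have "\<dots> = ennreal (a * (e + (L + exp (- L) * (2 * ((4 * A + 6) * 2 ^ J) * mg)) / l) + d)"
    using A_pos by (intro split[symmetric]) (auto simp: mg_def)
  finally show ?thesis by (simp add: e_def mg_def)
qed

end

text \<open>The target for \<open>2 ^ J\<close> is the smaller of \<open>U\<close>, which balances
  noise against truncation, and \<open>V\<close>, which balances contamination against truncation.
  The upper bound on \<open>2 ^ J\<close> controls noise and contamination, the lower bound controls
  truncation.\<close>

lemma tuning_rate_consequences:
  fixes J :: nat and \<alpha> \<beta> \<epsilon> K :: real
  assumes \<beta>: "\<beta> > 1 / 2" and \<epsilon>: "\<epsilon> \<in> {0..1}" and r: "log_ratio n \<alpha> > 0" and K: "K > 0"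
    and up: "2 ^ J \<le> ennreal K * tuning_rate \<beta> n \<alpha> \<epsilon>"
    and low: "tuning_rate \<beta> n \<alpha> \<epsilon> \<le> ennreal K * 2 ^ J"
  shows "2 ^ J \<le> K * log_ratio n \<alpha> powr (- 1 / (2 * \<beta> + 1))"
    and "2 ^ J * sqrt (log_ratio n \<alpha>) \<le> K * error_rate \<beta> n \<alpha> \<epsilon>"
    and "\<epsilon> * 2 ^ J \<le> K * error_rate \<beta> n \<alpha> \<epsilon>"
    and "2 powr (- (\<beta> - 1 / 2) * J) \<le> K powr (\<beta> - 1 / 2) * error_rate \<beta> n \<alpha> \<epsilon>"
proof -
  define r where "r = log_ratio n \<alpha>"
  define U where "U = r powr (- 1 / (2 * \<beta> + 1))"
  define V where "V = \<epsilon> powr (- 2 / (2 * \<beta> + 1))"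
  \<comment> \<open>The real value of the tuning rate. At \<open>\<epsilon> = 0\<close> the formula
    for \<open>V\<close> would give 0 instead of infinity, so \<open>U\<close> is taken
    directly.\<close>
  define T where "T = (if \<epsilon> = 0 then U else min U V)"
  have r0: "r > 0" using assms by (simp add: r_def)
  have U: "U > 0" using r0 by (simp add: U_def)
  have V: "V > 0" if "\<epsilon> \<noteq> 0" using that by (simp add: V_def)
  have T: "tuning_rate \<beta> n \<alpha> \<epsilon> = ennreal T" "T > 0"
    using U V unfolding tuning_rate_def T_def U_def V_def r_def
    by (cases "\<epsilon> = 0"; simp add: min_def ennreal_le_iff)+
  have pow: "(2::ennreal) ^ J = ennreal (2 ^ J)" by (simp flip: ennreal_power)
  have up': "2 ^ J \<le> K * T"
    using up K T unfolding T(1) pow by (simp flip: ennreal_mult)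
  have low': "T \<le> K * 2 ^ J"
    using low K T unfolding T(1) pow by (simp flip: ennreal_mult)
  have TU: "T \<le> U" by (simp add: T_def)
  have e1: "r powr ((2 * \<beta> - 1) / (4 * \<beta> + 2)) \<le> error_rate \<beta> n \<alpha> \<epsilon>"
    and e2: "\<epsilon> powr ((2 * \<beta> - 1) / (2 * \<beta> + 1)) \<le> error_rate \<beta> n \<alpha> \<epsilon>"
    by (simp_all add: error_rate_def r_def)
  show a: "2 ^ J \<le> K * log_ratio n \<alpha> powr (- 1 / (2 * \<beta> + 1))"
    using order_trans[OF up' mult_left_mono[OF TU]] K by (simp add: U_def r_def)
  have "2 ^ J * sqrt r \<le> K * U * r powr (1 / 2)"
    using a r0 by (auto simp: U_def r_def powr_half_sqrt intro!: mult_right_mono)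
  also have "\<dots> = K * r powr (- 1 / (2 * \<beta> + 1) + 1 / 2)" by (simp only: U_def powr_add mult.assoc)
  also have "- 1 / (2 * \<beta> + 1) + 1 / 2 = (2 * \<beta> - 1) / (4 * \<beta> + 2)"
    using \<beta> by (simp add: field_simps)
  finally show "2 ^ J * sqrt (log_ratio n \<alpha>) \<le> K * error_rate \<beta> n \<alpha> \<epsilon>"
    using order_trans[OF _ mult_left_mono[OF e1]] K by (simp add: r_def)
  show "\<epsilon> * 2 ^ J \<le> K * error_rate \<beta> n \<alpha> \<epsilon>"
  proof (cases "\<epsilon> = 0")
    case True
    have "0 \<le> error_rate \<beta> n \<alpha> \<epsilon>" using e1 by (rule order_trans[rotated]) simp
    then show ?thesis using True K by simp
  next
    case False
    then have "T \<le> V" by (simp add: T_def)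
    then have "\<epsilon> * 2 ^ J \<le> \<epsilon> * (K * V)"
      using up' \<epsilon> K by (intro mult_left_mono) (auto intro: order_trans[OF _ mult_left_mono])
    also have "\<dots> = K * (\<epsilon> powr 1 * \<epsilon> powr (- 2 / (2 * \<beta> + 1)))" using \<epsilon> by (simp add: V_def)
    also have "\<epsilon> powr 1 * \<epsilon> powr (- 2 / (2 * \<beta> + 1)) = \<epsilon> powr (1 + - 2 / (2 * \<beta> + 1))"
      by (simp only: powr_add)
    also have "1 + - 2 / (2 * \<beta> + 1) = (2 * \<beta> - 1) / (2 * \<beta> + 1)"
      using \<beta> by (simp add: field_simps)
    also have "K * \<epsilon> powr ((2 * \<beta> - 1) / (2 * \<beta> + 1)) \<le> K * error_rate \<beta> n \<alpha> \<epsilon>" using e2 K by (intro mult_left_mono) auto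
    finally show ?thesis .
  qed
  \<comment> \<open>Since \<open>T\<close> is \<open>U\<close> or \<open>V\<close>, this power is
    exactly one of the two terms whose maximum is the error rate.\<close>
  have Tpow: "T powr (- (\<beta> - 1 / 2)) \<le> error_rate \<beta> n \<alpha> \<epsilon>"
  proof (cases "T = U")
    case True
    have "- 1 / (2 * \<beta> + 1) * (- (\<beta> - 1 / 2)) = (2 * \<beta> - 1) / (4 * \<beta> + 2)"
      using \<beta> by (simp add: field_simps)
    then show ?thesis using e1 True by (simp add: U_def powr_powr)
  next
    case False
    then have "T = V" by (auto simp: T_def min_def split: if_splits)
    moreover have "- 2 / (2 * \<beta> + 1) * (- (\<beta> - 1 / 2)) = (2 * \<beta> - 1) / (2 * \<beta> + 1)"
      using \<beta> by (simp add: field_simps)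
    ultimately show ?thesis using e2 by (simp add: V_def powr_powr)
  qed
  have "2 powr (- (\<beta> - 1 / 2) * J) = (2 ^ J) powr (- (\<beta> - 1 / 2))"
    by (simp add: powr_powr mult.commute flip: powr_realpow)
  \<comment> \<open>The exponent is negative, so the lower bound on \<open>2 ^ J\<close> gives an
    upper bound here.\<close>
  also have "\<dots> \<le> (T / K) powr (- (\<beta> - 1 / 2))"
    using low' T K \<beta> by (intro powr_mono2') (auto simp: field_simps)
  also have "\<dots> = K powr (\<beta> - 1 / 2) * T powr (- (\<beta> - 1 / 2))"
    using T K by (simp add: powr_divide powr_minus field_simps)
  also have "\<dots> \<le> K powr (\<beta> - 1 / 2) * error_rate \<beta> n \<alpha> \<epsilon>"
    using Tpow by (intro mult_left_mono) auto
  finally show "2 powr (- (\<beta> - 1 / 2) * J) \<le> K powr (\<beta> - 1 / 2) * error_rate \<beta> n \<alpha> \<epsilon>" .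
qed

text \<open>A bound on the limsup holds for the ratio itself only after some slack, hence the added
  1. Positivity and finiteness of \<open>b n\<close> allow multiplying the extended quotient
  back.\<close>

lemma lesssim_const_eventually_le:
  assumes "lesssim_const K a b" and b: "eventually (\<lambda>n. 0 < b n \<and> b n < \<top>) sequentially"
  shows "eventually (\<lambda>n. a n \<le> ennreal (max K 0 + 1) * b n) sequentially"
proof -
  have "limsup (\<lambda>n. a n / b n) \<le> ennreal K" using assms by (simp add: lesssim_const_def)
  also have "\<dots> < ennreal (max K 0 + 1)"
    by (cases "K \<ge> 0") (auto simp: ennreal_less_iff ennreal_neg)
  finally have "eventually (\<lambda>n. a n / b n < ennreal (max K 0 + 1)) sequentially"
    by (rule Limsup_lessD)
  with b show ?thesis
  proof eventually_elim
    case (elim n)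
    have "b n \<noteq> 0" using elim by auto
    then have "a n = a n / b n * b n"
      using elim by (simp add: ennreal_divide_times ennreal_divide_self)
    also have "\<dots> \<le> ennreal (max K 0 + 1) * b n"
      using elim by (intro mult_right_mono) auto
    finally show ?case .
  qed
qed

lemma lesssim_constI:
  assumes "eventually (\<lambda>n. a n \<le> ennreal C * b n) sequentially" "eventually (\<lambda>n. 0 < b n) sequentially"
  shows "lesssim_const C a b"
  unfolding lesssim_const_def
proof (rule Limsup_bounded)
  show "eventually (\<lambda>n. a n / b n \<le> ennreal C) sequentially"
    using assms by eventually_elim (intro divide_le_posI_ennreal, auto simp: mult.commute)
qed

text \<open>To be used at \<open>x = n * \<alpha>^2\<close>. The factor \<open>1 / 4\<close> is what
  yields \<open>sqrt (n * ln x) \<le> n / 2\<close>, the admissibility of the exponential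
  parameter.\<close>

lemma eventually_ln_bounds: "eventually (\<lambda>x::real. 1 \<le> ln x \<and> ln x \<le> x / 4) at_top"
proof -
  have "((\<lambda>x::real. ln x / x) \<longlongrightarrow> 0) at_top" by (rule ln_x_over_x_tendsto_0)
  then have "eventually (\<lambda>x::real. ln x / x < 1 / 4) at_top"
    by (rule order_tendstoD) simp
  moreover have "eventually (\<lambda>x::real. 1 \<le> ln x) at_top"
    using ln_at_top by (simp add: filterlim_at_top)
  ultimately show ?thesis
    using eventually_gt_at_top[of 0] by eventually_elim (simp add: field_simps)
qed

section \<open>Choice of the free parameters and the explicit rate constant\<close>

context compact_wavelet
begin

definition noise_const :: real where
  "noise_const = (8 * of_int \<lceil>A\<rceil> + 4) * (SUP x. \<bar>\<psi> x\<bar>) * sqrt 2 * inverse (sqrt 2 - 1)"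

text \<open>Dominates the wavelet constant and the noise constant at once; the added 1 keeps it
  positive, so that \<open>\<tau>\<close> can be divided by.\<close>

definition spread_const :: real where "spread_const = wbound + noise_const + 1"

text \<open>The first summand collects contamination bias (\<open>2 * wbound\<close>) and stochastic
  deviation (\<open>spread_const\<close>), the second truncation; the final 1 ensures
  positivity.\<close>

definition rate_const :: "real \<Rightarrow> real \<Rightarrow> real \<Rightarrow> real" where
  "rate_const \<beta> R K = 4 * (2 * A + 1) * wbound * (2 * wbound + (4 + 2 * (4 * A + 6) * K) * spread_const) * K
    + tail_const \<beta> R * K powr (\<beta> - 1 / 2) + 1"

lemma noise_const_nonneg: "0 \<le> noise_const"
proof -
  have "0 \<le> (of_int \<lceil>A\<rceil> :: real)" using A_pos by linarith
  then show ?thesis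
    using SUP_abs_nonneg[OF bounded_psi] by (simp add: noise_const_def)
qed

lemma rate_const_pos: "\<beta> > 1 / 2 \<Longrightarrow> K > 0 \<Longrightarrow> 0 < rate_const \<beta> R K"
  using A_pos wbound_nonneg noise_const_nonneg tail_const_nonneg[of \<beta> R]
  unfolding rate_const_def spread_const_def by (intro add_nonneg_pos add_nonneg_nonneg mult_nonneg_nonneg) auto

text \<open>With \<open>u = ln (n * \<alpha>^2)\<close> the free parameters are
  \<open>L = 4 * u\<close> and \<open>l = sqrt (n * u) / \<tau>\<close>. The moment bound becomes
  \<open>exp (3 * u)\<close>, so the damping leaves a factor \<open>exp (- u)\<close>, which
  outweighs the number of coefficients.\<close>

lemma risk_le_rate:
  fixes n J :: nat and \<alpha> \<epsilon> K :: real
  defines "a \<equiv> 4 * (2 * A + 1) * wbound * 2 powr (real J / 2)"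
  assumes f: "f \<in> sobolev_class \<phi> \<psi> \<beta>" and \<beta>: "\<beta> > 1 / 2"
    and G: "prob_space G" "sets G = sets borel" and \<epsilon>: "\<epsilon> \<in> {0..1}"
    and priv: "private_sample \<phi> \<psi> n J (contaminated \<epsilon> (density lborel f) G) M X W"
    and \<alpha>: "\<alpha> \<in> {0<..<1}" and m1: "1 \<le> ln (n * \<alpha>\<^sup>2)" and m2: "ln (n * \<alpha>\<^sup>2) \<le> n * \<alpha>\<^sup>2 / 4"
    and K: "K > 0" and up: "2 ^ J \<le> ennreal K * tuning_rate \<beta> n \<alpha> \<epsilon>"
    and low: "tuning_rate \<beta> n \<alpha> \<epsilon> \<le> ennreal K * 2 ^ J"
    and N: "\<And>b E. (\<And>j k. j \<in> {-1..int J} \<Longrightarrow> k \<in> active \<phi> \<psi> j \<Longrightarrow> \<bar>b j k - wav_coeff \<phi> \<psi> f j k\<bar> \<le> E)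
      \<Longrightarrow> 0 \<le> E \<Longrightarrow>
      N (\<lambda>x. (\<Sum>j\<in>{-1..int J}. \<Sum>k\<in>active \<phi> \<psi> j. b j k * w j k x) - f x)
        \<le> ennreal (a * E + tail_const \<beta> R * 2 powr (- (\<beta> - 1 / 2) * J))"
  shows "risk N M (f_Lap A \<phi> \<psi> \<alpha> J n X W) f \<le> ennreal (rate_const \<beta> R K) * ennreal (error_rate \<beta> n \<alpha> \<epsilon>)"
proof -
  define m where "m = n * \<alpha>\<^sup>2"
  define u where "u = ln m"
  define r where "r = log_ratio n \<alpha>"
  define er where "er = error_rate \<beta> n \<alpha> \<epsilon>"
  define \<tau> where "\<tau> = spread_const * 2 powr (real J / 2) / \<alpha>"
  define l where "l = sqrt (n * u) / \<tau>"
  have u: "1 \<le> u" "u \<le> m / 4" using m1 m2 by (simp_all add: u_def m_def)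
  then have m: "4 \<le> m" by simp
  have "m \<le> real n * 1" unfolding m_def using \<alpha> by (intro mult_left_mono) (auto simp: power_le_one)
  then have mn: "m \<le> n" by simp
  then have n: "n \<ge> 1" "0 < real n" using m by auto
  have r_eq: "r = u / m" by (simp add: r_def log_ratio_def u_def m_def)
  have r0: "0 < r" using u m by (simp add: r_eq)
  have sp: "1 \<le> spread_const" using wbound_nonneg noise_const_nonneg by (simp add: spread_const_def)
  have \<tau>0: "0 < \<tau>" using sp \<alpha> by (auto simp: \<tau>_def intro!: divide_pos_pos mult_pos_pos)
  note tc = tuning_rate_consequences[OF \<beta> \<epsilon> r0[unfolded r_def] K up low, folded r_def er_def]
  have er0: "0 < er"
  proof -
    have "0 < r powr ((2 * \<beta> - 1) / (4 * \<beta> + 2))" using r0 by simp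
    then show ?thesis by (simp add: er_def error_rate_def r_def less_max_iff_disj)
  qed
  have \<tau>_ge: "c * 2 powr (real J / 2) / \<alpha> \<le> \<tau>" if "c \<le> spread_const" for c
    unfolding \<tau>_def using that \<alpha> by (intro divide_right_mono mult_right_mono) auto
  have "wbound * 2 powr (real J / 2) \<le> wbound * 2 powr (real J / 2) / \<alpha>"
    using \<alpha> wbound_nonneg by (simp add: pos_le_divide_eq mult_right_le_one_le)
  also have "\<dots> \<le> \<tau>" using noise_const_nonneg by (intro \<tau>_ge) (simp add: spread_const_def)
  finally have \<tau>1: "wbound * 2 powr (real J / 2) \<le> \<tau>" .
  have "noise_scale A \<psi> \<alpha> J = noise_const * 2 powr (real J / 2) / \<alpha>"
    by (simp add: noise_scale_def noise_const_def)
  moreover have "\<dots> \<le> \<tau>" using wbound_nonneg by (intro \<tau>_ge) (simp add: spread_const_def)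
  ultimately have \<tau>2: "\<bar>noise_scale A \<psi> \<alpha> J\<bar> \<le> \<tau>" using noise_const_nonneg \<alpha> by simp
  have l0: "0 < l" using \<tau>0 n u by (simp add: l_def)
  have "sqrt (n * u) \<le> n / 2"
  proof (rule real_le_lsqrt)
    have "n * u \<le> n * (n / 4)" using u mn by (intro mult_left_mono) auto
    then show "n * u \<le> (n / 2)\<^sup>2" by (simp add: power2_eq_square)
  qed (use n u in auto)
  then have l1: "l * \<tau> \<le> n / 2" using \<tau>0 by (simp add: l_def)
  have l2: "3 * l\<^sup>2 * \<tau>\<^sup>2 / n = 3 * u"
    using \<tau>0 n u by (simp add: l_def power_divide)
  have "risk N M (f_Lap A \<phi> \<psi> \<alpha> J n X W) f \<le>
    ennreal (a * (2 * \<epsilon> * wbound * 2 powr (real J / 2)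
      + (4 * u + exp (- (4 * u)) * (2 * ((4 * A + 6) * 2 ^ J) * exp (3 * l\<^sup>2 * \<tau>\<^sup>2 / n))) / l)
      + tail_const \<beta> R * 2 powr (- (\<beta> - 1 / 2) * J))"
    unfolding a_def using u tail_const_nonneg[OF \<beta>] N
    by (intro risk_le[OF f G \<epsilon> priv n(1) \<tau>1 \<tau>2 l0 l1]) (auto simp: a_def)
  also have "\<dots> \<le> ennreal (rate_const \<beta> R K * er)"
  proof (rule ennreal_leI)
    have "exp (- (4 * u)) * exp (3 * u) = exp (- u)" by (simp flip: exp_add)
    also have "\<dots> = 1 / m" using m by (simp add: u_def exp_minus inverse_eq_divide)
    finally have "exp (- (4 * u)) * exp (3 * u) = 1 / m" .
    moreover have "exp (- (4 * u)) * (2 * ((4 * A + 6) * 2 ^ J) * exp (3 * u)) =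
        2 * (4 * A + 6) * (2 ^ J * (exp (- (4 * u)) * exp (3 * u)))"
      by (simp only: mult_ac)
    ultimately have "exp (- (4 * u)) * (2 * ((4 * A + 6) * 2 ^ J) * exp (3 * u)) = 2 * (4 * A + 6) * (2 ^ J / m)"
      by simp
    \<comment> \<open>The union bound costs at most a constant, because the choice of
      \<open>J\<close> forces \<open>2 ^ J \<le> K * m\<close>.\<close>
    also have "\<dots> \<le> 2 * (4 * A + 6) * K"
    proof -
      have "2 ^ J \<le> K * r powr (- 1 / (2 * \<beta> + 1))" by (rule tc(1))
      also have "r powr (- 1 / (2 * \<beta> + 1)) = (m / u) powr (1 / (2 * \<beta> + 1))"
        using m u by (simp add: r_eq powr_minus_divide powr_divide)
      also have "\<dots> \<le> m powr (1 / (2 * \<beta> + 1))"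
        using m u \<beta> by (intro powr_mono2) (auto simp: field_simps)
      also have "\<dots> \<le> m powr 1"
        using m \<beta> by (intro powr_mono) auto
      finally have "2 ^ J \<le> K * m" using K m by simp
      then show ?thesis using m A_pos by (intro mult_left_mono) (auto simp: field_simps)
    qed
    also have "\<dots> \<le> 2 * (4 * A + 6) * K * u"
      using mult_left_mono[OF u(1), of "2 * (4 * A + 6) * K"] A_pos K by simp
    finally have "4 * u + exp (- (4 * u)) * (2 * ((4 * A + 6) * 2 ^ J) * exp (3 * u))
        \<le> (4 + 2 * (4 * A + 6) * K) * u" by (simp add: algebra_simps)
    then have "(4 * u + exp (- (4 * u)) * (2 * ((4 * A + 6) * 2 ^ J) * exp (3 * l\<^sup>2 * \<tau>\<^sup>2 / n))) / l
        \<le> (4 + 2 * (4 * A + 6) * K) * u / l"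
      unfolding l2 using l0 by (intro divide_right_mono) auto
    also have "\<dots> = (4 + 2 * (4 * A + 6) * K) * (u / l)" by simp
    \<comment> \<open>Inserting \<open>l\<close> and \<open>\<tau>\<close> gives
      \<open>\<tau> * sqrt (u / n)\<close>; the factor \<open>1 / \<alpha>\<close> in
      \<open>\<tau>\<close> turns \<open>sqrt (u / n)\<close> into \<open>sqrt r\<close>.\<close>
    also have "u / l = spread_const * 2 powr (real J / 2) * sqrt r"
    proof -
      have "u / sqrt (n * u) = sqrt u / sqrt n"
        using u n by (simp add: real_sqrt_mult real_div_sqrt divide_simps)
      moreover have "sqrt r = sqrt u / sqrt n / \<alpha>"
        using \<alpha> by (simp add: r_eq m_def real_sqrt_divide real_sqrt_mult)
      moreover have "u / l = spread_const * 2 powr (real J / 2) * (u / sqrt (n * u)) / \<alpha>"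
        by (simp add: l_def \<tau>_def)
      ultimately show ?thesis by simp
    qed
    finally have dev: "(4 * u + exp (- (4 * u)) * (2 * ((4 * A + 6) * 2 ^ J) * exp (3 * l\<^sup>2 * \<tau>\<^sup>2 / n))) / l
        \<le> (4 + 2 * (4 * A + 6) * K) * (spread_const * 2 powr (real J / 2) * sqrt r)" .
    have a0: "0 \<le> a" using A_pos wbound_nonneg by (simp add: a_def)
    have pp: "2 powr (real J / 2) * 2 powr (real J / 2) = (2::real) ^ J"
      by (simp add: powr_realpow flip: powr_add)
    let ?A = "4 * (2 * A + 1) * wbound" and ?B = "(4 + 2 * (4 * A + 6) * K) * spread_const"
    have nn: "0 \<le> ?A" "0 \<le> ?B" using A_pos wbound_nonneg K sp by auto
    have "a * (2 * \<epsilon> * wbound * 2 powr (real J / 2)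
        + (4 * u + exp (- (4 * u)) * (2 * ((4 * A + 6) * 2 ^ J) * exp (3 * l\<^sup>2 * \<tau>\<^sup>2 / n))) / l)
      \<le> a * (2 * \<epsilon> * wbound * 2 powr (real J / 2)
        + (4 + 2 * (4 * A + 6) * K) * (spread_const * 2 powr (real J / 2) * sqrt r))"
      using dev a0 by (intro mult_left_mono) auto
    also have "\<dots> = ?A * (2 * wbound * (\<epsilon> * (2 powr (real J / 2) * 2 powr (real J / 2)))
        + ?B * ((2 powr (real J / 2) * 2 powr (real J / 2)) * sqrt r))"
      by (simp add: a_def algebra_simps)
    \<comment> \<open>The two factors \<open>2 powr (J / 2)\<close>, one from the sup norm of the
      wavelets and one from the coefficient errors, combine to the \<open>2 ^ J\<close> bounded
      through the tuning rate.\<close>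
    also have "\<dots> \<le> ?A * (2 * wbound * (K * er) + ?B * (K * er))"
      unfolding pp using nn wbound_nonneg tc(2,3) by (intro mult_left_mono add_mono) auto
    finally have 1: "a * (2 * \<epsilon> * wbound * 2 powr (real J / 2)
        + (4 * u + exp (- (4 * u)) * (2 * ((4 * A + 6) * 2 ^ J) * exp (3 * l\<^sup>2 * \<tau>\<^sup>2 / n))) / l)
      \<le> ?A * (2 * wbound * (K * er) + ?B * (K * er))" .
    have 2: "tail_const \<beta> R * 2 powr (- (\<beta> - 1 / 2) * J) \<le> tail_const \<beta> R * (K powr (\<beta> - 1 / 2) * er)"
      using tc(4) tail_const_nonneg[OF \<beta>] by (intro mult_left_mono) auto
    have "rate_const \<beta> R K * er = ?A * (2 * wbound * (K * er) + ?B * (K * er))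
        + tail_const \<beta> R * (K powr (\<beta> - 1 / 2) * er) + er"
      unfolding rate_const_def by (simp add: algebra_simps)
    then show "a * (2 * \<epsilon> * wbound * 2 powr (real J / 2)
        + (4 * u + exp (- (4 * u)) * (2 * ((4 * A + 6) * 2 ^ J) * exp (3 * l\<^sup>2 * \<tau>\<^sup>2 / n))) / l)
        + tail_const \<beta> R * 2 powr (- (\<beta> - 1 / 2) * J) \<le> rate_const \<beta> R K * er"
      using 1 2 er0 by linarith
  qed
  also have "\<dots> = ennreal (rate_const \<beta> R K) * ennreal er"
    using er0 rate_const_pos[OF \<beta> K, of R] by (simp add: ennreal_mult)
  finally show ?thesis by (simp add: er_def)
qed

lemma sup_norm_error_le:
  assumes "sobolev_sum \<phi> \<psi> \<beta> f \<le> ennreal R" "\<beta> > 1 / 2" "is_wavelet_series \<phi> \<psi> f"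
    and "\<And>j k. j \<in> {-1..int J} \<Longrightarrow> k \<in> active \<phi> \<psi> j \<Longrightarrow> \<bar>b j k - wav_coeff \<phi> \<psi> f j k\<bar> \<le> E" "0 \<le> E"
  shows "sup_norm (\<lambda>x. (\<Sum>j\<in>{-1..int J}. \<Sum>k\<in>active \<phi> \<psi> j. b j k * w j k x) - f x)
    \<le> ennreal (4 * (2 * A + 1) * wbound * 2 powr (J / 2) * E + tail_const \<beta> R * 2 powr (- (\<beta> - 1 / 2) * J))"
  using assms by (intro sup_norm_le estimation_error_le) (auto simp: is_wavelet_series_def)

text \<open>Every member of the class agrees with its wavelet series almost everywhere, which
  suffices for the essential supremum.\<close>

lemma ess_sup_norm_error_le:
  assumes R: "sobolev_sum \<phi> \<psi> \<beta> f \<le> ennreal R" and \<beta>: "\<beta> > 1 / 2" and f: "f \<in> sobolev_class \<phi> \<psi> \<beta>"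
    and b: "\<And>j k. j \<in> {-1..int J} \<Longrightarrow> k \<in> active \<phi> \<psi> j \<Longrightarrow> \<bar>b j k - wav_coeff \<phi> \<psi> f j k\<bar> \<le> E" "0 \<le> E"
  shows "ess_sup_norm (\<lambda>x. (\<Sum>j\<in>{-1..int J}. \<Sum>k\<in>active \<phi> \<psi> j. b j k * w j k x) - f x)
    \<le> ennreal (4 * (2 * A + 1) * wbound * 2 powr (J / 2) * E + tail_const \<beta> R * 2 powr (- (\<beta> - 1 / 2) * J))"
proof (rule ess_sup_norm_le)
  have "f \<in> borel_measurable borel" using f by (simp add: sobolev_class_def)
  then show "(\<lambda>x. (\<Sum>j\<in>{-1..int J}. \<Sum>k\<in>active \<phi> \<psi> j. b j k * w j k x) - f x) \<in> borel_measurable borel"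
    by measurable
  show "AE x in lborel. \<bar>(\<Sum>j\<in>{-1..int J}. \<Sum>k\<in>active \<phi> \<psi> j. b j k * w j k x) - f x\<bar>
    \<le> 4 * (2 * A + 1) * wbound * 2 powr (J / 2) * E + tail_const \<beta> R * 2 powr (- (\<beta> - 1 / 2) * J)"
    using sobolev_AE_wavelet_series[OF f \<beta>]
    by eventually_elim (rule estimation_error_le[OF R \<beta> _ b])
qed

end

text \<open>The constant is fixed before all sequences, so it is uniform over densities,
  contaminations and probability spaces that vary with \<open>n\<close>. The class fixes a density
  only up to null sets; the true supremum is therefore treated for the version given by its
  series.\<close>

theorem theorem8:
  fixes A \<beta> R K :: real and \<phi> \<psi> :: "real \<Rightarrow> real"
  assumes "wavelet_pair A \<phi> \<psi>" and "\<beta> > 1 / 2"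
  shows "\<exists>C>0. \<forall>(\<alpha> :: nat \<Rightarrow> real) (\<epsilon> :: nat \<Rightarrow> real) (J :: nat \<Rightarrow> nat) (f :: nat \<Rightarrow> real \<Rightarrow> real)
      (G :: nat \<Rightarrow> real measure) (M :: nat \<Rightarrow> 'a measure) (X :: nat \<Rightarrow> nat \<Rightarrow> 'a \<Rightarrow> real)
      (W :: nat \<Rightarrow> nat \<times> int \<times> int \<Rightarrow> 'a \<Rightarrow> real).
    (\<forall>n. \<alpha> n \<in> {0<..<1}) \<and> (\<forall>n. \<epsilon> n \<in> {0..1}) \<and>
    filterlim (\<lambda>n. real n * (\<alpha> n)\<^sup>2) at_top sequentially \<and>
    (\<forall>n. J n \<ge> 1) \<and> asymp_const K (\<lambda>n. 2 ^ J n) (\<lambda>n. tuning_rate \<beta> n (\<alpha> n) (\<epsilon> n)) \<and>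
    (\<forall>n. f n \<in> sobolev_class \<phi> \<psi> \<beta> \<and> sobolev_sum \<phi> \<psi> \<beta> (f n) \<le> ennreal R) \<and>
    (\<forall>n. prob_space (G n) \<and> sets (G n) = sets borel \<and> emeasure (G n) {0..1} = 1) \<and>
    (\<forall>n. private_sample \<phi> \<psi> n (J n) (contaminated (\<epsilon> n) (density lborel (f n)) (G n)) (M n) (X n) (W n))
    \<longrightarrow>
    lesssim_const C
      (\<lambda>n. risk ess_sup_norm (M n) (f_Lap A \<phi> \<psi> (\<alpha> n) (J n) n (X n) (W n)) (f n))
      (\<lambda>n. ennreal (error_rate \<beta> n (\<alpha> n) (\<epsilon> n))) \<and>
    ((\<forall>n. is_wavelet_series \<phi> \<psi> (f n)) \<longrightarrow>
      lesssim_const C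
        (\<lambda>n. risk sup_norm (M n) (f_Lap A \<phi> \<psi> (\<alpha> n) (J n) n (X n) (W n)) (f n))
        (\<lambda>n. ennreal (error_rate \<beta> n (\<alpha> n) (\<epsilon> n))))"
proof -
  interpret compact_wavelet A \<phi> \<psi> by standard fact
  \<comment> \<open>The constant with slack from \<open>lesssim_const_eventually_le\<close>, valid
    eventually in both directions of the comparison.\<close>
  define K' where "K' = max K 0 + 1"
  have K': "K' > 0" by (simp add: K'_def)
  show ?thesis
  proof (intro exI[of _ "rate_const \<beta> R K'"] conjI allI impI rate_const_pos K' \<open>\<beta> > 1 / 2\<close>; (elim conjE)?)
    fix \<alpha> \<epsilon> :: "nat \<Rightarrow> real" and J :: "nat \<Rightarrow> nat" and f :: "nat \<Rightarrow> real \<Rightarrow> real"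
      and G :: "nat \<Rightarrow> real measure" and M :: "nat \<Rightarrow> 'a measure" and X :: "nat \<Rightarrow> nat \<Rightarrow> 'a \<Rightarrow> real"
      and W :: "nat \<Rightarrow> nat \<times> int \<times> int \<Rightarrow> 'a \<Rightarrow> real"
    assume \<alpha>: "\<forall>n. \<alpha> n \<in> {0<..<1}" and \<epsilon>: "\<forall>n. \<epsilon> n \<in> {0..1}"
      and m: "filterlim (\<lambda>n. real n * (\<alpha> n)\<^sup>2) at_top sequentially"
      and asymp: "asymp_const K (\<lambda>n. 2 ^ J n) (\<lambda>n. tuning_rate \<beta> n (\<alpha> n) (\<epsilon> n))"
      and f: "\<forall>n. f n \<in> sobolev_class \<phi> \<psi> \<beta> \<and> sobolev_sum \<phi> \<psi> \<beta> (f n) \<le> ennreal R"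
      and G: "\<forall>n. prob_space (G n) \<and> sets (G n) = sets borel \<and> emeasure (G n) {0..1} = 1"
      and priv: "\<forall>n. private_sample \<phi> \<psi> n (J n) (contaminated (\<epsilon> n) (density lborel (f n)) (G n)) (M n) (X n) (W n)"
    have ln: "eventually (\<lambda>n. 1 \<le> ln (n * (\<alpha> n)\<^sup>2) \<and> ln (n * (\<alpha> n)\<^sup>2) \<le> n * (\<alpha> n)\<^sup>2 / 4) sequentially"
      using filterlim_iff[THEN iffD1, OF m] eventually_ln_bounds by blast
    have ratio: "eventually (\<lambda>n. 0 < log_ratio n (\<alpha> n)) sequentially"
      using ln by eventually_elim (auto simp: log_ratio_def intro!: divide_pos_pos)
    have tr: "eventually (\<lambda>n. 0 < tuning_rate \<beta> n (\<alpha> n) (\<epsilon> n) \<and> tuning_rate \<beta> n (\<alpha> n) (\<epsilon> n) < \<top>) sequentially"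
      using ratio by eventually_elim (auto simp: tuning_rate_def min_less_iff_disj)
    have er: "eventually (\<lambda>n. 0 < ennreal (error_rate \<beta> n (\<alpha> n) (\<epsilon> n))) sequentially"
      using ratio by eventually_elim (auto simp: error_rate_def less_max_iff_disj)
    have up: "eventually (\<lambda>n. 2 ^ J n \<le> ennreal K' * tuning_rate \<beta> n (\<alpha> n) (\<epsilon> n)) sequentially"
      using asymp tr unfolding asymp_const_def K'_def by (intro lesssim_const_eventually_le) auto
    have pow: "0 < (2 :: ennreal) ^ k \<and> (2 :: ennreal) ^ k < \<top>" for k
    proof -
      have "(2 :: ennreal) ^ k = ennreal (2 ^ k)" by (simp flip: ennreal_power)
      then show ?thesis by simp
    qed
    have low: "eventually (\<lambda>n. tuning_rate \<beta> n (\<alpha> n) (\<epsilon> n) \<le> ennreal K' * 2 ^ J n) sequentially"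
      unfolding K'_def
      by (rule lesssim_const_eventually_le[OF conjunct2[OF asymp[unfolded asymp_const_def]]])
        (intro always_eventually allI pow)
    show "lesssim_const (rate_const \<beta> R K')
      (\<lambda>n. risk ess_sup_norm (M n) (f_Lap A \<phi> \<psi> (\<alpha> n) (J n) n (X n) (W n)) (f n))
      (\<lambda>n. ennreal (error_rate \<beta> n (\<alpha> n) (\<epsilon> n)))"
    proof (rule lesssim_constI[OF _ er])
      show "eventually (\<lambda>n. risk ess_sup_norm (M n) (f_Lap A \<phi> \<psi> (\<alpha> n) (J n) n (X n) (W n)) (f n)
          \<le> ennreal (rate_const \<beta> R K') * ennreal (error_rate \<beta> n (\<alpha> n) (\<epsilon> n))) sequentially"
        using ln up low
      proof eventually_elim
        case (elim n)
        show ?case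
          using f G \<epsilon> priv \<alpha> elim K' \<open>\<beta> > 1 / 2\<close>
          by (intro risk_le_rate[where G = "G n"] ess_sup_norm_error_le) auto
      qed
    qed
    assume series: "\<forall>n. is_wavelet_series \<phi> \<psi> (f n)"
    show "lesssim_const (rate_const \<beta> R K')
      (\<lambda>n. risk sup_norm (M n) (f_Lap A \<phi> \<psi> (\<alpha> n) (J n) n (X n) (W n)) (f n))
      (\<lambda>n. ennreal (error_rate \<beta> n (\<alpha> n) (\<epsilon> n)))"
    proof (rule lesssim_constI[OF _ er])
      show "eventually (\<lambda>n. risk sup_norm (M n) (f_Lap A \<phi> \<psi> (\<alpha> n) (J n) n (X n) (W n)) (f n)
          \<le> ennreal (rate_const \<beta> R K') * ennreal (error_rate \<beta> n (\<alpha> n) (\<epsilon> n))) sequentially"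
        using ln up low
      proof eventually_elim
        case (elim n)
        show ?case
          using f G \<epsilon> priv \<alpha> elim K' \<open>\<beta> > 1 / 2\<close> series
          by (intro risk_le_rate[where G = "G n"] sup_norm_error_le) auto
      qed
    qed
  qed
qed

end
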